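(* Let $\frac{\partial}{\partial t}\gamma(t)=q(\gamma(t))$ be a geometric flow which is diffeomorphism invariant. Let $\gamma(t)$ be a $G$-invariant solution on a homogeneous space $G/K$ with maximal interval of existence $(T_-,T_+)\ni 0$. If $T_+<\infty$, then $$\int_0^{T_+}|q(\gamma(t))|_t\,dt=\infty ,$$ and if $T_->-\infty$, then $$\int_{T_-}^0|q(\gamma(t))|_t\,dt=\infty .$$
   Context: **Geometric structures and flow.** A class of geometric structures on $n$-dimensional manifolds is fixed; each structure is a tensor field $\gamma$ (or a tuple of tensor fields) of a fixed type such that on each tangent space $V$ the admissible (non-degenerate) values form a single orbit $\mathrm{GL}(V)\cdot\gamma$, open in the vector space $T$ of all tensors of that type on $V$. To each structure $\gamma$ on $M$ is assigned a tensor field $q(\gamma)$ of the same type. Diffeomorphism invariance means $q(\varphi^*\gamma)=\varphi^*q(\gamma)$ for every diffeomorphism $\varphi$ (possibly between different manifolds). **Homogeneous spaces.** $G$ is simply connected, $K$ is connected and closed, $G/K$ is almost-effective (the normal subgroup of $G$ acting trivially is discrete), $\mathfrak g=\mathfrak k\oplus\mathfrak p$ is an $\mathrm{Ad}(K)$-invariant decomposition, $\mathfrak p\equiv T_o(G/K)$, and $G$-invariant structures are identified with $\mathrm{Ad}(K)$-invariant non-degenerate tensors on $\mathfrak p$. For them the flow is an ODE (with smooth right-hand side) on tensors on $\mathfrak p$, and $(T_-,T_+)$ is the maximal interval of existence of $\gamma(t)$, $\gamma(0)=\gamma$, among non-degenerate tensors, $-\infty\le T_-<0<T_+\le\infty$.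 **Norms.** $\mathrm{GL}(\mathfrak p)$ acts on tensors by $h\cdot\gamma=(h^{-1})^*\gamma$, and $\theta(A)\gamma:=\frac{d}{dt}|_0e^{tA}\cdot\gamma$. $G_\gamma$ is the stabilizer of $\gamma$, $\mathfrak g_\gamma=\{A\in\mathfrak{gl}(\mathfrak p):\theta(A)\gamma=0\}$; an $\mathrm{Ad}(G_\gamma)$-invariant complement $\mathfrak q_\gamma$ of $\mathfrak g_\gamma$ in $\mathfrak{gl}(\mathfrak p)$ is fixed and $\mathfrak q_{h\cdot\gamma}:=h\mathfrak q_\gamma h^{-1}$. Let $Q(t)\in\mathfrak q_{\gamma(t)}$ be the unique operator with $q(\gamma(t))=\theta(Q(t))\gamma(t)$ and let $h(t)\in\mathrm{GL}(\mathfrak p)$ solve $\frac{d}{dt}h(t)=-h(t)Q(t)$, $h(0)=I$ (then $\gamma(t)=h(t)^*\gamma$). Fix an inner product $\langle\cdot,\cdot\rangle$ on $\mathfrak p$. The norm $|\cdot|_t$ on tensors on $\mathfrak p$ is the one induced by the inner product $\langle\cdot,\cdot\rangle_t:=h(t)^*\langle\cdot,\cdot\rangle=\langle h(t)\cdot,h(t)\cdot\rangle$. *)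

theory Defs
  imports "HOL-Analysis.Analysis" "HOL-Algebra.Coset"
begin

section \<open>Smooth maps between subsets of Euclidean spaces\<close>

primrec Ck_on :: "nat \<Rightarrow> 'a::euclidean_space set \<Rightarrow> ('a \<Rightarrow> 'b::euclidean_space) \<Rightarrow> bool" where
  "Ck_on 0 S f \<longleftrightarrow> continuous_on S f"
| "Ck_on (Suc k) S f \<longleftrightarrow>
     (\<forall>x\<in>S. f differentiable (at x)) \<and> (\<forall>v. Ck_on k S (\<lambda>x. frechet_derivative f (at x) v))"

text \<open>Meant for open \<open>S\<close>.\<close>
definition smooth_on :: "'a::euclidean_space set \<Rightarrow> ('a \<Rightarrow> 'b::euclidean_space) \<Rightarrow> bool" where
  "smooth_on S f \<longleftrightarrow> (\<forall>k. Ck_on k S f)"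

text \<open>A smooth vector field on a relatively open subset \<open>U\<close> of a linear subspace \<open>W\<close>; smoothness
  on the possibly lower-dimensional set \<open>U\<close> means local existence of smooth extensions.\<close>
definition smooth_vector_field ::
    "'a::euclidean_space set \<Rightarrow> 'a set \<Rightarrow> ('a \<Rightarrow> 'a) \<Rightarrow> bool" where
  "smooth_vector_field W U X \<longleftrightarrow>
     (\<forall>x\<in>U. X x \<in> W) \<and>
     (\<forall>x\<in>U. \<exists>N f. open N \<and> x \<in> N \<and> smooth_on N f \<and> (\<forall>y\<in>N \<inter> U. f y = X y))"

section \<open>Manifolds\<close>

text \<open>A chart is a pair of a domain and a coordinate map (relevant only on the domain). Atlases need
  not be maximal.\<close>
type_synonym ('m, 'e) chart = "'m set \<times> ('m \<Rightarrow> 'e)"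

record ('m, 'e) mfd =
  mtop :: "'m topology"
  atlas :: "('m, 'e) chart set"

definition chart_inv :: "('m, 'e) chart \<Rightarrow> 'e \<Rightarrow> 'm" where
  "chart_inv c = inv_into (fst c) (snd c)"

definition second_countable_space :: "'m topology \<Rightarrow> bool" where
  "second_countable_space X \<longleftrightarrow>
     (\<exists>\<B>. countable \<B> \<and> (\<forall>B\<in>\<B>. openin X B) \<and>
          (\<forall>U x. openin X U \<and> x \<in> U \<longrightarrow> (\<exists>B\<in>\<B>. x \<in> B \<and> B \<subseteq> U)))"

definition manifold :: "('m, 'e::euclidean_space) mfd \<Rightarrow> bool" where
  "manifold M \<longleftrightarrow>
     Hausdorff_space (mtop M) \<and> second_countable_space (mtop M) \<and>
     (\<forall>c\<in>atlas M. openin (mtop M) (fst c) \<and> open (snd c ` fst c) \<and>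
        homeomorphic_map (subtopology (mtop M) (fst c)) (top_of_set (snd c ` fst c)) (snd c)) \<and>
     (\<Union>c\<in>atlas M. fst c) = topspace (mtop M) \<and>
     (\<forall>c\<in>atlas M. \<forall>d\<in>atlas M.
        smooth_on (snd c ` (fst c \<inter> fst d)) (snd d \<circ> chart_inv c))"

definition smooth_map ::
    "('m, 'e::euclidean_space) mfd \<Rightarrow> ('k, 'f::euclidean_space) mfd \<Rightarrow> ('m \<Rightarrow> 'k) \<Rightarrow> bool" where
  "smooth_map M N f \<longleftrightarrow>
     continuous_map (mtop M) (mtop N) f \<and>
     (\<forall>c\<in>atlas M. \<forall>d\<in>atlas N.
        smooth_on (snd c ` {x \<in> fst c. f x \<in> fst d}) (snd d \<circ> f \<circ> chart_inv c))"

definition diffeomorphism ::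
    "('m, 'e::euclidean_space) mfd \<Rightarrow> ('k, 'e) mfd \<Rightarrow> ('m \<Rightarrow> 'k) \<Rightarrow> bool" where
  "diffeomorphism M N f \<longleftrightarrow>
     bij_betw f (topspace (mtop M)) (topspace (mtop N)) \<and>
     smooth_map M N f \<and> smooth_map N M (inv_into (topspace (mtop M)) f)"

definition prod_mfd :: "('m, 'e) mfd \<Rightarrow> ('k, 'f) mfd \<Rightarrow> ('m \<times> 'k, 'e \<times> 'f) mfd" where
  "prod_mfd M N =
     \<lparr>mtop = prod_topology (mtop M) (mtop N),
      atlas = {(fst c \<times> fst d, map_prod (snd c) (snd d)) | c d. c \<in> atlas M \<and> d \<in> atlas N}\<rparr>"

definition open_submfd :: "('m, 'e) mfd \<Rightarrow> 'm set \<Rightarrow> ('m, 'e) mfd" where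
  "open_submfd M U =
     \<lparr>mtop = subtopology (mtop M) U, atlas = {(fst c \<inter> U, snd c) | c. c \<in> atlas M}\<rparr>"

text \<open>Jacobian at \<open>x\<close> of \<open>f\<close>, read in the chart \<open>c\<close> of the source and \<open>d\<close> of the target.\<close>
definition jacobian ::
    "('m, real^'n) chart \<Rightarrow> ('k, real^'n) chart \<Rightarrow> ('m \<Rightarrow> 'k) \<Rightarrow> 'm \<Rightarrow> real^'n^'n" where
  "jacobian c d f x = matrix (frechet_derivative (snd d \<circ> f \<circ> chart_inv c) (at (snd c x)))"

section \<open>Tensors\<close>

text \<open>A value of type \<open>('k, 's, 'n) tensor\<close> is the array of components, with respect to a basis
  indexed by \<open>'n\<close>, of a tuple (indexed by \<open>'k\<close>) of tensors whose slots are indexed by \<open>'s\<close>.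
  A function \<open>var\<close> records the variance of each slot of each member of the tuple; slots marked
  \<open>Unused\<close> carry the trivial representation, so that tuples of tensors of different ranks are
  included. Tensors with symmetries are obtained below by restricting to an invariant subspace.\<close>

datatype variance = Contravariant | Covariant | Unused

type_synonym ('k, 's, 'n) tensor = "real ^ ('k \<times> ('s \<Rightarrow> 'n))"

text \<open>The action \<open>h \<cdot> \<gamma> = (h\<^sup>-\<^sup>1)\<^sup>* \<gamma>\<close> in components. If \<open>h\<close> is the matrix of an isomorphism
  between two spaces with bases, this is the induced isomorphism of the spaces of tensors.\<close>
definition slot_coeff :: "variance \<Rightarrow> real^'n^'n \<Rightarrow> 'n \<Rightarrow> 'n \<Rightarrow> real" where
  "slot_coeff v h i j =
     (case v of Contravariant \<Rightarrow> h $ i $ j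
              | Covariant \<Rightarrow> matrix_inv h $ j $ i
              | Unused \<Rightarrow> (if i = j then 1 else 0))"

definition tact ::
    "('k \<Rightarrow> 's \<Rightarrow> variance) \<Rightarrow> real^'n^'n \<Rightarrow> ('k::finite, 's::finite, 'n::finite) tensor
      \<Rightarrow> ('k, 's, 'n) tensor" where
  "tact var h \<gamma> =
     (\<chi> kI. \<Sum>J\<in>UNIV. (\<Prod>s\<in>UNIV. slot_coeff (var (fst kI) s) h (snd kI s) (J s)) * \<gamma> $ (fst kI, J))"

definition mat_exp :: "real^'n^'n \<Rightarrow> real^'n^'n" where
  "mat_exp A = (\<Sum>k. (1 / fact k) *\<^sub>R (((**) A ^^ k) (mat 1)))"

text \<open>The infinitesimal action \<open>\<theta>\<close>.\<close>
definition inf_act ::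
    "('k \<Rightarrow> 's \<Rightarrow> variance) \<Rightarrow> real^'n^'n \<Rightarrow> ('k::finite, 's::finite, 'n::finite) tensor
      \<Rightarrow> ('k, 's, 'n) tensor" where
  "inf_act var A \<gamma> = vector_derivative (\<lambda>t. tact var (mat_exp (t *\<^sub>R A)) \<gamma>) (at 0)"

definition stabilizer ::
    "('k \<Rightarrow> 's \<Rightarrow> variance) \<Rightarrow> ('k::finite, 's::finite, 'n::finite) tensor \<Rightarrow> (real^'n^'n) set" where
  "stabilizer var \<gamma> = {h. invertible h \<and> tact var h \<gamma> = \<gamma>}"

definition inf_stabilizer ::
    "('k \<Rightarrow> 's \<Rightarrow> variance) \<Rightarrow> ('k::finite, 's::finite, 'n::finite) tensor \<Rightarrow> (real^'n^'n) set" where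
  "inf_stabilizer var \<gamma> = {A. inf_act var A \<gamma> = 0}"

definition invariant_complement ::
    "('k \<Rightarrow> 's \<Rightarrow> variance) \<Rightarrow> ('k::finite, 's::finite, 'n::finite) tensor
      \<Rightarrow> (real^'n^'n) set \<Rightarrow> bool" where
  "invariant_complement var \<gamma> \<qq> \<longleftrightarrow>
     subspace \<qq> \<and> inf_stabilizer var \<gamma> \<inter> \<qq> = {0} \<and>
     (\<forall>A. \<exists>B\<in>inf_stabilizer var \<gamma>. \<exists>C\<in>\<qq>. A = B + C) \<and>
     (\<forall>h\<in>stabilizer var \<gamma>. \<forall>A\<in>\<qq>. h ** A ** matrix_inv h \<in> \<qq>)"

text \<open>\<open>transported_complement var \<gamma> \<qq> \<delta>\<close> is \<open>\<qq>\<^sub>\<delta> = h \<qq>\<^sub>\<gamma> h\<^sup>-\<^sup>1\<close> for \<open>\<delta> = h \<cdot> \<gamma>\<close>;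
  by invariance of \<open>\<qq> = \<qq>\<^sub>\<gamma>\<close> all such \<open>h\<close> give the same space.\<close>
definition transported_complement ::
    "('k \<Rightarrow> 's \<Rightarrow> variance) \<Rightarrow> ('k::finite, 's::finite, 'n::finite) tensor
      \<Rightarrow> (real^'n^'n) set \<Rightarrow> ('k, 's, 'n) tensor \<Rightarrow> (real^'n^'n) set" where
  "transported_complement var \<gamma> \<qq> \<delta> =
     {h ** A ** matrix_inv h | h A. invertible h \<and> \<delta> = tact var h \<gamma> \<and> A \<in> \<qq>}"

definition inner_product :: "(real^'n \<Rightarrow> real^'n \<Rightarrow> real) \<Rightarrow> bool" where
  "inner_product b \<longleftrightarrow> bilinear b \<and> (\<forall>v w. b v w = b w v) \<and> (\<forall>v. v \<noteq> 0 \<longrightarrow> b v v > 0)"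

text \<open>The norm induced on tensors by an inner product \<open>b\<close>: indices are contracted with the Gram
  matrix of \<open>b\<close> (contravariant slots) or its inverse (covariant slots).\<close>
definition gram :: "(real^'n \<Rightarrow> real^'n \<Rightarrow> real) \<Rightarrow> real^'n^'n" where
  "gram b = (\<chi> i j. b (axis i 1) (axis j 1))"

definition slot_metric :: "variance \<Rightarrow> real^'n^'n \<Rightarrow> 'n \<Rightarrow> 'n \<Rightarrow> real" where
  "slot_metric v B i j =
     (case v of Contravariant \<Rightarrow> B $ i $ j
              | Covariant \<Rightarrow> matrix_inv B $ i $ j
              | Unused \<Rightarrow> (if i = j then 1 else 0))"

definition tensor_norm ::
    "('k \<Rightarrow> 's \<Rightarrow> variance) \<Rightarrow> (real^'n \<Rightarrow> real^'n \<Rightarrow> real)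
      \<Rightarrow> ('k::finite, 's::finite, 'n::finite) tensor \<Rightarrow> real" where
  "tensor_norm var b \<gamma> =
     sqrt (\<Sum>k\<in>UNIV. \<Sum>I\<in>UNIV. \<Sum>J\<in>UNIV.
       (\<Prod>s\<in>UNIV. slot_metric (var k s) (gram b) (I s) (J s)) * \<gamma> $ (k, I) * \<gamma> $ (k, J))"

section \<open>Geometric structures and diffeomorphism invariant flows\<close>

text \<open>\<open>T\<close> is the space of all tensors of the given type on \<open>\<real>\<^sup>n\<close> and \<open>S\<close> the set of non-degenerate
  ones. Both are \<open>GL(n)\<close>-invariant, hence make sense on every \<open>n\<close>-dimensional vector space.\<close>
definition structure_type ::
    "('k \<Rightarrow> 's \<Rightarrow> variance) \<Rightarrow> ('k::finite, 's::finite, 'n::finite) tensor set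
      \<Rightarrow> ('k, 's, 'n) tensor set \<Rightarrow> bool" where
  "structure_type var T S \<longleftrightarrow>
     subspace T \<and> (\<forall>h. invertible h \<longrightarrow> tact var h ` T \<subseteq> T) \<and>
     (\<exists>\<gamma>\<in>T. S = {tact var h \<gamma> | h. invertible h}) \<and>
     openin (top_of_set T) S"

text \<open>A tensor field is given by its components in every chart at every point of the chart domain,
  subject to the transformation law; irrelevant values are \<open>0\<close>.\<close>
type_synonym ('m, 'k, 's, 'n) field = "('m, real^'n) chart \<Rightarrow> 'm \<Rightarrow> ('k, 's, 'n) tensor"

definition tensor_field ::
    "('k \<Rightarrow> 's \<Rightarrow> variance) \<Rightarrow> ('k::finite, 's::finite, 'n::finite) tensor set
      \<Rightarrow> ('m, real^'n) mfd \<Rightarrow> ('m, 'k, 's, 'n) field \<Rightarrow> bool" where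
  "tensor_field var T M \<Gamma> \<longleftrightarrow>
     (\<forall>c x. \<not> (c \<in> atlas M \<and> x \<in> fst c) \<longrightarrow> \<Gamma> c x = 0) \<and>
     (\<forall>c\<in>atlas M. \<forall>x\<in>fst c. \<Gamma> c x \<in> T) \<and>
     (\<forall>c\<in>atlas M. \<forall>d\<in>atlas M. \<forall>x\<in>fst c \<inter> fst d.
        \<Gamma> d x = tact var (jacobian c d (\<lambda>y. y) x) (\<Gamma> c x)) \<and>
     (\<forall>c\<in>atlas M. smooth_on (snd c ` fst c) (\<Gamma> c \<circ> chart_inv c))"

definition geometric_structure ::
    "('k \<Rightarrow> 's \<Rightarrow> variance) \<Rightarrow> ('k::finite, 's::finite, 'n::finite) tensor set
      \<Rightarrow> ('k, 's, 'n) tensor set \<Rightarrow> ('m, real^'n) mfd \<Rightarrow> ('m, 'k, 's, 'n) field \<Rightarrow> bool" where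
  "geometric_structure var T S M \<Gamma> \<longleftrightarrow>
     tensor_field var T M \<Gamma> \<and> (\<forall>c\<in>atlas M. \<forall>x\<in>fst c. \<Gamma> c x \<in> S)"

text \<open>The value does not depend on the chart \<open>d\<close> around \<open>\<phi> x\<close> when \<open>\<Gamma>\<close> is a tensor field.\<close>
definition pullback ::
    "('k \<Rightarrow> 's \<Rightarrow> variance) \<Rightarrow> ('m, real^'n) mfd \<Rightarrow> ('l, real^'n) mfd \<Rightarrow> ('m \<Rightarrow> 'l)
      \<Rightarrow> ('l, 'k::finite, 's::finite, 'n::finite) field \<Rightarrow> ('m, 'k, 's, 'n) field" where
  "pullback var M N \<phi> \<Gamma> =
     (\<lambda>c x. if c \<in> atlas M \<and> x \<in> fst c
            then let d = (SOME d. d \<in> atlas N \<and> \<phi> x \<in> fst d)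
                 in tact var (matrix_inv (jacobian c d \<phi> x)) (\<Gamma> d (\<phi> x))
            else 0)"

text \<open>\<open>q M \<Gamma>\<close> is the right-hand side at the structure \<open>\<Gamma>\<close> on \<open>M\<close>.\<close>
definition diffeo_invariant_flow ::
    "('k \<Rightarrow> 's \<Rightarrow> variance) \<Rightarrow> ('k::finite, 's::finite, 'n::finite) tensor set
      \<Rightarrow> ('k, 's, 'n) tensor set
      \<Rightarrow> (('m, real^'n) mfd \<Rightarrow> ('m, 'k, 's, 'n) field \<Rightarrow> ('m, 'k, 's, 'n) field) \<Rightarrow> bool" where
  "diffeo_invariant_flow var T S q \<longleftrightarrow>
     (\<forall>M \<Gamma>. manifold M \<and> geometric_structure var T S M \<Gamma> \<longrightarrow> tensor_field var T M (q M \<Gamma>)) \<and>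
     (\<forall>M N \<phi> \<Gamma>. manifold M \<and> manifold N \<and> diffeomorphism M N \<phi> \<and>
        geometric_structure var T S N \<Gamma> \<longrightarrow>
        q M (pullback var M N \<phi> \<Gamma>) = pullback var M N \<phi> (q N \<Gamma>))"

section \<open>Homogeneous spaces\<close>

definition lie_group :: "'g monoid \<Rightarrow> ('g, 'e::euclidean_space) mfd \<Rightarrow> bool" where
  "lie_group G MG \<longleftrightarrow>
     group G \<and> manifold MG \<and> topspace (mtop MG) = carrier G \<and>
     smooth_map (prod_mfd MG MG) MG (\<lambda>(x, y). x \<otimes>\<^bsub>G\<^esub> y) \<and>
     smooth_map MG MG (\<lambda>x. inv\<^bsub>G\<^esub> x)"

text \<open>All loops are freely homotopic; this includes path connectedness, as for the library's
  \<open>simply_connected\<close>.\<close>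
definition simply_connected_top :: "'m topology \<Rightarrow> bool" where
  "simply_connected_top X \<longleftrightarrow>
     (\<forall>f g. pathin X f \<and> f 1 = f 0 \<and> pathin X g \<and> g 1 = g 0 \<longrightarrow>
        homotopic_with (\<lambda>r. r 1 = r 0) (top_of_set {0..1::real}) X f g)"

text \<open>The manifold structure on the space of left cosets is the unique one for which the projection
  is smooth and admits smooth local sections.\<close>
definition quotient_manifold ::
    "'g monoid \<Rightarrow> ('g, 'e::euclidean_space) mfd \<Rightarrow> 'g set \<Rightarrow> ('g set, 'f::euclidean_space) mfd \<Rightarrow> bool"
  where
  "quotient_manifold G MG K M \<longleftrightarrow>
     manifold M \<and> topspace (mtop M) = {g <#\<^bsub>G\<^esub> K | g. g \<in> carrier G} \<and>
     smooth_map MG M (\<lambda>g. g <#\<^bsub>G\<^esub> K) \<and>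
     (\<forall>x\<in>topspace (mtop M). \<exists>U s. openin (mtop M) U \<and> x \<in> U \<and>
        smooth_map (open_submfd M U) MG s \<and> (\<forall>y\<in>U. s y <#\<^bsub>G\<^esub> K = y))"

definition homogeneous_space ::
    "'g monoid \<Rightarrow> ('g, 'e::euclidean_space) mfd \<Rightarrow> 'g set \<Rightarrow> ('g set, 'f::euclidean_space) mfd \<Rightarrow> bool"
  where
  "homogeneous_space G MG K M \<longleftrightarrow>
     lie_group G MG \<and> simply_connected_top (mtop MG) \<and>
     subgroup K G \<and> closedin (mtop MG) K \<and> connectedin (mtop MG) K \<and>
     quotient_manifold G MG K M \<and>
     (let N = {g \<in> carrier G. \<forall>x\<in>topspace (mtop M). g <#\<^bsub>G\<^esub> x = x}
      in subtopology (mtop MG) N = discrete_topology N)"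

text \<open>The Lie algebra of \<open>G\<close> is the tangent space at the identity, identified with the model space
  by a chart \<open>c0\<close> around the identity.\<close>
definition Ad :: "'g monoid \<Rightarrow> ('g, 'e::euclidean_space) chart \<Rightarrow> 'g \<Rightarrow> 'e \<Rightarrow> 'e" where
  "Ad G c0 k =
     frechet_derivative (\<lambda>z. snd c0 (k \<otimes>\<^bsub>G\<^esub> chart_inv c0 z \<otimes>\<^bsub>G\<^esub> inv\<^bsub>G\<^esub> k)) (at (snd c0 \<one>\<^bsub>G\<^esub>))"

definition sub_lie_algebra ::
    "'g monoid \<Rightarrow> ('g, 'e::euclidean_space) mfd \<Rightarrow> ('g, 'e) chart \<Rightarrow> 'g set \<Rightarrow> 'e set" where
  "sub_lie_algebra G MG c0 K =
     {X. \<exists>\<sigma>. continuous_map euclideanreal (mtop MG) \<sigma> \<and> range \<sigma> \<subseteq> K \<and>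
          (\<forall>s t. \<sigma> (s + t) = \<sigma> s \<otimes>\<^bsub>G\<^esub> \<sigma> t) \<and>
          ((snd c0 \<circ> \<sigma>) has_vector_derivative X) (at 0)}"

definition reductive_complement ::
    "'g monoid \<Rightarrow> ('g, 'e::euclidean_space) mfd \<Rightarrow> ('g, 'e) chart \<Rightarrow> 'g set \<Rightarrow> 'e set \<Rightarrow> bool" where
  "reductive_complement G MG c0 K \<pp> \<longleftrightarrow>
     subspace \<pp> \<and> sub_lie_algebra G MG c0 K \<inter> \<pp> = {0} \<and>
     (\<forall>X. \<exists>Y\<in>sub_lie_algebra G MG c0 K. \<exists>Z\<in>\<pp>. X = Y + Z) \<and>
     (\<forall>k\<in>K. Ad G c0 k ` \<pp> \<subseteq> \<pp>)"

text \<open>A basis of \<open>\<pp>\<close>, as an isomorphism \<open>\<real>\<^sup>n \<rightarrow> \<pp>\<close>. Tensors, operators and inner products on \<open>\<pp>\<close>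
  are represented by their components in this basis.\<close>
definition basis_iso :: "'e::euclidean_space set \<Rightarrow> (real^'n \<Rightarrow> 'e) \<Rightarrow> bool" where
  "basis_iso \<pp> F \<longleftrightarrow> linear F \<and> inj F \<and> range F = \<pp>"

definition Ad_mat ::
    "'g monoid \<Rightarrow> ('g, 'e::euclidean_space) chart \<Rightarrow> (real^'n \<Rightarrow> 'e) \<Rightarrow> 'g \<Rightarrow> real^'n^'n" where
  "Ad_mat G c0 F k = matrix (\<lambda>v. inv_into UNIV F (Ad G c0 k (F v)))"

definition Ad_invariants ::
    "('k \<Rightarrow> 's \<Rightarrow> variance) \<Rightarrow> ('k::finite, 's::finite, 'n::finite) tensor set \<Rightarrow> 'g monoid
      \<Rightarrow> ('g, 'e::euclidean_space) chart \<Rightarrow> 'g set \<Rightarrow> (real^'n \<Rightarrow> 'e) \<Rightarrow> ('k, 's, 'n) tensor set" where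
  "Ad_invariants var T G c0 K F = {\<gamma> \<in> T. \<forall>k\<in>K. tact var (Ad_mat G c0 F k) \<gamma> = \<gamma>}"

text \<open>Matrix, in the basis \<open>F\<close> of \<open>\<pp>\<close> and the chart \<open>c\<close> around \<open>gK\<close>, of the isomorphism
  \<open>\<pp> \<equiv> T\<^sub>o(G/K) \<rightarrow> T\<^sub>g\<^sub>K(G/K)\<close> given by the differential of the action of \<open>g\<close>.\<close>
definition frame_at ::
    "'g monoid \<Rightarrow> ('g, 'e::euclidean_space) chart \<Rightarrow> 'g set \<Rightarrow> (real^'n \<Rightarrow> 'e) \<Rightarrow> 'g
      \<Rightarrow> ('g set, real^'n) chart \<Rightarrow> real^'n^'n" where
  "frame_at G c0 K F g c =
     matrix (\<lambda>v. frechet_derivative (\<lambda>z. snd c ((g \<otimes>\<^bsub>G\<^esub> chart_inv c0 z) <#\<^bsub>G\<^esub> K))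
                   (at (snd c0 \<one>\<^bsub>G\<^esub>)) (F v))"

text \<open>The \<open>G\<close>-invariant tensor field on \<open>G/K\<close> with value \<open>\<gamma>\<close> on \<open>\<pp> \<equiv> T\<^sub>o(G/K)\<close>; the choice of \<open>g\<close>
  is immaterial when \<open>\<gamma>\<close> is \<open>Ad(K)\<close>-invariant.\<close>
definition invariant_field ::
    "('k \<Rightarrow> 's \<Rightarrow> variance) \<Rightarrow> 'g monoid \<Rightarrow> ('g, 'e::euclidean_space) chart \<Rightarrow> 'g set
      \<Rightarrow> ('g set, real^'n) mfd \<Rightarrow> (real^'n \<Rightarrow> 'e) \<Rightarrow> ('k::finite, 's::finite, 'n::finite) tensor
      \<Rightarrow> ('g set, 'k, 's, 'n) field" where
  "invariant_field var G c0 K M F \<gamma> =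
     (\<lambda>c x. if c \<in> atlas M \<and> x \<in> fst c
            then tact var (frame_at G c0 K F (SOME g. g \<in> carrier G \<and> g <#\<^bsub>G\<^esub> K = x) c) \<gamma>
            else 0)"

definition value_at_origin ::
    "('k \<Rightarrow> 's \<Rightarrow> variance) \<Rightarrow> 'g monoid \<Rightarrow> ('g, 'e::euclidean_space) chart \<Rightarrow> 'g set
      \<Rightarrow> ('g set, real^'n) mfd \<Rightarrow> (real^'n \<Rightarrow> 'e) \<Rightarrow> ('g set, 'k, 's, 'n) field
      \<Rightarrow> ('k::finite, 's::finite, 'n::finite) tensor" where
  "value_at_origin var G c0 K M F \<Gamma> =
     (let c = (SOME c. c \<in> atlas M \<and> K \<in> fst c)
      in tact var (matrix_inv (frame_at G c0 K F \<one>\<^bsub>G\<^esub> c)) (\<Gamma> c K))"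

text \<open>The right-hand side of the flow as a map on tensors on \<open>\<pp>\<close>.\<close>
definition hom_rhs ::
    "('k \<Rightarrow> 's \<Rightarrow> variance)
      \<Rightarrow> (('g set, real^'n) mfd \<Rightarrow> ('g set, 'k, 's, 'n) field \<Rightarrow> ('g set, 'k, 's, 'n) field)
      \<Rightarrow> 'g monoid \<Rightarrow> ('g, 'e::euclidean_space) chart \<Rightarrow> 'g set \<Rightarrow> ('g set, real^'n) mfd
      \<Rightarrow> (real^'n \<Rightarrow> 'e) \<Rightarrow> ('k::finite, 's::finite, 'n::finite) tensor \<Rightarrow> ('k, 's, 'n) tensor" where
  "hom_rhs var q G c0 K M F \<gamma> =
     value_at_origin var G c0 K M F (q M (invariant_field var G c0 K M F \<gamma>))"

section \<open>Maximal solutions\<close>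

definition ereal_interval :: "ereal \<Rightarrow> ereal \<Rightarrow> real set" where
  "ereal_interval a b = {t. a < ereal t \<and> ereal t < b}"

definition ode_solution ::
    "'a::real_normed_vector set \<Rightarrow> ('a \<Rightarrow> 'a) \<Rightarrow> ereal \<Rightarrow> ereal \<Rightarrow> (real \<Rightarrow> 'a) \<Rightarrow> bool" where
  "ode_solution D X a b \<gamma> \<longleftrightarrow>
     (\<forall>t\<in>ereal_interval a b. \<gamma> t \<in> D \<and> (\<gamma> has_vector_derivative X (\<gamma> t)) (at t))"

definition maximal_ode_solution ::
    "'a::real_normed_vector set \<Rightarrow> ('a \<Rightarrow> 'a) \<Rightarrow> ereal \<Rightarrow> ereal \<Rightarrow> (real \<Rightarrow> 'a) \<Rightarrow> bool" where
  "maximal_ode_solution D X a b \<gamma> \<longleftrightarrow>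
     ode_solution D X a b \<gamma> \<and>
     (\<forall>a' b' \<delta>. a' \<le> a \<and> b \<le> b' \<and> ode_solution D X a' b' \<delta> \<and>
        (\<forall>t\<in>ereal_interval a b. \<delta> t = \<gamma> t) \<longrightarrow> a' = a \<and> b' = b)"

end

theory Submission
  imports Defs
begin

text \<open>Transporting the solution back by the gauge \<open>h\<close> gives the constant \<open>h(t) \<cdot> \<gamma>(t) = \<gamma>(0)\<close>. Since \<open>h(t)\<close>
  is an isometry from \<open>\<langle>\<cdot>,\<cdot>\<rangle>\<^sub>t\<close> to \<open>\<langle>\<cdot>,\<cdot>\<rangle>\<close>, the number \<open>|q(\<gamma>(t))|\<^sub>t\<close> is the fixed norm of \<open>\<theta>(A) \<gamma>(0)\<close>,
  where \<open>A = h Q h\<^sup>-\<^sup>1\<close> lies in the fixed complement, on which \<open>A \<mapsto> \<theta>(A) \<gamma>(0)\<close> is injective; hence it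
  dominates a multiple of \<open>|A|\<close>. As \<open>h' = - A h\<close> and \<open>(h\<^sup>-\<^sup>1)' = h\<^sup>-\<^sup>1 A\<close>, finiteness of the integral
  makes \<open>h\<close> and \<open>h\<^sup>-\<^sup>1\<close> converge at the end of the interval, by Gronwall's inequality. So
  \<open>\<gamma>(t) = h(t)\<^sup>-\<^sup>1 \<cdot> \<gamma>(0)\<close> converges within the orbit of \<open>\<gamma>(0)\<close>, that is, to a non-degenerate invariant
  tensor, and the solution can be continued, contradicting maximality. The past follows from the future
  by reversing time.\<close>

section \<open>Calculus of matrices\<close>

text \<open>\<open>matrix_inv\<close> is a choice among two-sided inverses. For square matrices a
  right inverse is also a left inverse, so one equation pins the choice down.\<close>

lemma matrix_inv_unique:
  fixes A B :: "real^'n^'n"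
  assumes "A ** B = mat 1"
  shows "matrix_inv A = B"
proof -
  have "B ** A = mat 1"
    using assms matrix_left_right_inverse by blast
  then have "invertible A"
    using assms by (auto simp: invertible_def)
  then have "A ** matrix_inv A = mat 1"
    unfolding matrix_inv_def invertible_def by (rule someI_ex[THEN conjunct1])
  then show ?thesis
    by (metis \<open>B ** A = mat 1\<close> matrix_mul_assoc matrix_mul_lid matrix_mul_rid)
qed

lemma matrix_inv_right [simp]:
  fixes A :: "real^'n^'n"
  shows "invertible A \<Longrightarrow> A ** matrix_inv A = mat 1"
  by (metis invertible_def matrix_inv_unique)

lemma matrix_inv_left [simp]:
  fixes A :: "real^'n^'n"
  shows "invertible A \<Longrightarrow> matrix_inv A ** A = mat 1"
  using matrix_inv_right matrix_left_right_inverse by blast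

lemma invertible_matrix_inv [simp]:
  fixes A :: "real^'n^'n"
  shows "invertible A \<Longrightarrow> invertible (matrix_inv A)"
  by (metis invertible_def matrix_inv_left matrix_inv_right)

lemma matrix_inv_mat_1 [simp]: "matrix_inv (mat 1 :: real^'n^'n) = mat 1"
  by (simp add: matrix_inv_unique)

lemma invertible_mat_1 [simp]: "invertible (mat 1 :: real^'n^'n)"
  by (auto simp: invertible_def intro: exI[of _ "mat 1"])

lemma matrix_inv_mult:
  fixes A B :: "real^'n^'n"
  assumes "invertible A" "invertible B"
  shows "matrix_inv (A ** B) = matrix_inv B ** matrix_inv A"
proof (rule matrix_inv_unique)
  have "A ** B ** (matrix_inv B ** matrix_inv A) = A ** (B ** matrix_inv B) ** matrix_inv A"
    by (simp only: matrix_mul_assoc)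
  then show "A ** B ** (matrix_inv B ** matrix_inv A) = mat 1"
    using assms by simp
qed

lemma bounded_bilinear_matrix_mult:
  "bounded_bilinear ((**) :: real^'n^'n \<Rightarrow> real^'n^'n \<Rightarrow> real^'n^'n)"
  unfolding bilinear_conv_bounded_bilinear [symmetric] bilinear_def
  by (auto intro!: linearI simp: matrix_add_ldistrib vec_eq_iff matrix_matrix_mult_def sum.distrib
      algebra_simps sum_distrib_left)

lemmas matrix_mult_minus_left = bounded_bilinear.minus_left [OF bounded_bilinear_matrix_mult]
lemmas matrix_mult_minus_right = bounded_bilinear.minus_right [OF bounded_bilinear_matrix_mult]
lemmas tendsto_matrix_mult = bounded_bilinear.tendsto [OF bounded_bilinear_matrix_mult]

section \<open>Limits and derivatives of matrix-valued curves\<close>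

lemma has_vector_derivative_vec_iff:
  fixes f :: "real \<Rightarrow> 'a::real_normed_vector ^ 'n"
  shows "(f has_vector_derivative D) (at t) \<longleftrightarrow>
           (\<forall>i. ((\<lambda>s. f s $ i) has_vector_derivative D $ i) (at t))"
proof
  assume "(f has_vector_derivative D) (at t)"
  then show "\<forall>i. ((\<lambda>s. f s $ i) has_vector_derivative D $ i) (at t)"
    using bounded_linear.has_vector_derivative[OF bounded_linear_vec_nth] by blast
next
  assume *: "\<forall>i. ((\<lambda>s. f s $ i) has_vector_derivative D $ i) (at t)"
  show "(f has_vector_derivative D) (at t)"
    unfolding has_vector_derivative_def has_derivative_def
  proof
    show "((\<lambda>y. (f y - f (netlimit (at t)) - (y - netlimit (at t)) *\<^sub>R D) /\<^sub>R
             norm (y - netlimit (at t))) \<longlongrightarrow> 0) (at t)"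
      by (rule vec_tendstoI)
        (use * in \<open>auto simp: has_vector_derivative_def has_derivative_def\<close>)
  qed (rule bounded_linear_scaleR_left)
qed

lemma tendsto_det:
  fixes f :: "'a \<Rightarrow> real^'n^'n"
  assumes "(f \<longlongrightarrow> A) F"
  shows "((\<lambda>x. det (f x)) \<longlongrightarrow> det A) F"
  unfolding det_def by (intro tendsto_intros assms)

text \<open>Cramer's rule writes every entry of the inverse as a quotient of determinants, which are
  polynomials in the entries; the denominator has a nonzero limit.\<close>

lemma tendsto_matrix_inv:
  fixes f :: "'a \<Rightarrow> real^'n^'n"
  assumes f: "(f \<longlongrightarrow> A) F" and A: "invertible A"
  shows "((\<lambda>x. matrix_inv (f x)) \<longlongrightarrow> matrix_inv A) F"
proof -
  \<comment> \<open>Entry \<open>i\<close>, \<open>j\<close> is coordinate \<open>i\<close> of the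
    solution of \<open>B *v v = axis j 1\<close>, so the numerator has column \<open>i\<close> of
    \<open>B\<close> replaced by \<open>axis j 1\<close>.\<close>
  define inv' :: "real^'n^'n \<Rightarrow> real^'n^'n" where
    "inv' B = (\<chi> i j. det (\<chi> r c. if c = i then axis j 1 $ r else B $ r $ c) / det B)" for B
  have inv': "matrix_inv B = inv' B" if "det B \<noteq> 0" for B :: "real^'n^'n"
  proof -
    have inv: "invertible B"
      using that by (simp add: invertible_det_nz)
    have "(\<chi> i. matrix_inv B $ i $ j) = (\<chi> i. inv' B $ i $ j)" for j
    proof -
      have "B *v (\<chi> i. matrix_inv B $ i $ j) = axis j 1"
        using matrix_inv_right[OF inv]
        by (auto simp: vec_eq_iff matrix_vector_mult_def matrix_matrix_mult_def mat_def axis_def)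
      then show ?thesis
        using cramer[OF that] by (simp add: inv'_def)
    qed
    then show ?thesis
      by (simp add: vec_eq_iff)
  qed
  have detA: "det A \<noteq> 0"
    using A by (simp add: invertible_det_nz)
  have entries: "((\<lambda>x. (\<chi> r c. if c = i then axis j 1 $ r else f x $ r $ c) :: real^'n^'n) \<longlongrightarrow>
      (\<chi> r c. if c = i then axis j 1 $ r else A $ r $ c)) F" for i j
    by (intro vec_tendstoI) (auto intro!: tendsto_intros f)
  have "((\<lambda>x. inv' (f x)) \<longlongrightarrow> inv' A) F"
    unfolding inv'_def by (intro tendsto_vec_lambda tendsto_divide tendsto_det entries f detA)
  moreover have "\<forall>\<^sub>F x in F. inv' (f x) = matrix_inv (f x)"
    using tendsto_imp_eventually_ne[OF tendsto_det[OF f] detA] by eventually_elim (simp add: inv')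
  ultimately show ?thesis
    unfolding inv'[OF detA] by (rule Lim_transform_eventually)
qed

text \<open>On the real line the remainder can be divided by the signed increment instead of its
  norm. This form suits algebraic identities between difference quotients, as for the inverse
  matrix.\<close>

lemma has_vector_derivative_iff_quotient:
  fixes f :: "real \<Rightarrow> 'a::real_normed_vector"
  shows "(f has_vector_derivative D) (at t) \<longleftrightarrow> ((\<lambda>s. (f s - f t) /\<^sub>R (s - t)) \<longlongrightarrow> D) (at t)"
proof -
  have "((\<lambda>y. (f y - f t - (y - t) *\<^sub>R D) /\<^sub>R norm (y - t)) \<longlongrightarrow> 0) (at t) \<longleftrightarrow>
        ((\<lambda>s. (f s - f t) /\<^sub>R (s - t) - D) \<longlongrightarrow> 0) (at t)"
    unfolding tendsto_norm_zero_iff[symmetric, of "\<lambda>y. (f y - f t - (y - t) *\<^sub>R D) /\<^sub>R norm (y - t)"]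
      tendsto_norm_zero_iff[symmetric, of "\<lambda>s. (f s - f t) /\<^sub>R (s - t) - D"]
  proof (rule filterlim_cong[OF refl refl])
    show "\<forall>\<^sub>F x in at t. norm ((f x - f t - (x - t) *\<^sub>R D) /\<^sub>R norm (x - t)) =
            norm ((f x - f t) /\<^sub>R (x - t) - D)"
    proof (rule eventually_at_topological[THEN iffD2], intro exI[of _ UNIV] conjI ballI impI)
      fix x assume "x \<noteq> t"
      then have "(f x - f t) /\<^sub>R (x - t) - D = (f x - f t - (x - t) *\<^sub>R D) /\<^sub>R (x - t)"
        by (simp add: scaleR_diff_right)
      then show "norm ((f x - f t - (x - t) *\<^sub>R D) /\<^sub>R norm (x - t)) =
            norm ((f x - f t) /\<^sub>R (x - t) - D)"
        by simp
    qed auto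
  qed
  then show ?thesis
    by (simp add: has_vector_derivative_def has_derivative_def bounded_linear_scaleR_left
        LIM_zero_iff)
qed

text \<open>The identity g(s)^-1 (g(s) - g(t)) g(t)^-1 = g(t)^-1 - g(s)^-1, valid near
  \<open>t\<close>, expresses the difference quotient of the inverse through that of
  \<open>g\<close>; continuity of inversion gives the limit.\<close>

lemma has_vector_derivative_matrix_inv:
  fixes g :: "real \<Rightarrow> real^'n^'n"
  assumes g: "(g has_vector_derivative A) (at t)" and inv: "invertible (g t)"
  shows "((\<lambda>s. matrix_inv (g s)) has_vector_derivative
           - (matrix_inv (g t) ** A ** matrix_inv (g t))) (at t)"
  unfolding has_vector_derivative_iff_quotient
proof -
  interpret mm: bounded_bilinear "(**) :: real^'n^'n \<Rightarrow> real^'n^'n \<Rightarrow> real^'n^'n"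
    by (rule bounded_bilinear_matrix_mult)
  have cont: "(g \<longlongrightarrow> g t) (at t)"
    using has_vector_derivative_continuous[OF g] by (simp only: isCont_def)
  have lim: "((\<lambda>s. - (matrix_inv (g s) ** ((g s - g t) /\<^sub>R (s - t)) ** matrix_inv (g t)))
      \<longlongrightarrow> - (matrix_inv (g t) ** A ** matrix_inv (g t))) (at t)"
    using g unfolding has_vector_derivative_iff_quotient
    by (intro tendsto_minus tendsto_matrix_mult tendsto_matrix_inv[OF cont inv] tendsto_const)
  have "\<forall>\<^sub>F s in at t. invertible (g s)"
    using tendsto_imp_eventually_ne[OF tendsto_det[OF cont]] inv by (simp add: invertible_det_nz)
  then have "\<forall>\<^sub>F s in at t. - (matrix_inv (g s) ** ((g s - g t) /\<^sub>R (s - t)) ** matrix_inv (g t))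
      = (matrix_inv (g s) - matrix_inv (g t)) /\<^sub>R (s - t)"
  proof eventually_elim
    case (elim s)
    have "matrix_inv (g s) ** (g s - g t) ** matrix_inv (g t) = matrix_inv (g t) - matrix_inv (g s)"
      using elim inv by (simp add: mm.diff_left mm.diff_right flip: matrix_mul_assoc)
    then show ?case
      by (simp add: mm.scaleR_left mm.scaleR_right flip: scaleR_minus_right)
  qed
  then show "((\<lambda>s. (matrix_inv (g s) - matrix_inv (g t)) /\<^sub>R (s - t))
      \<longlongrightarrow> - (matrix_inv (g t) ** A ** matrix_inv (g t))) (at t)"
    by (rule Lim_transform_eventually[OF lim])
qed

section \<open>The action of the linear group on tensors\<close>

text \<open>A covariant slot uses the inverse matrix with its indices exchanged. Inversion and
  transposition each reverse the order of factors, so every variance gives a left action.\<close>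

lemma slot_coeff_mult:
  fixes h k :: "real^'n^'n"
  assumes "invertible h" "invertible k"
  shows "slot_coeff v (h ** k) i j = (\<Sum>m\<in>UNIV. slot_coeff v h i m * slot_coeff v k m j)"
proof (cases v)
  case Unused
  have "(\<Sum>m\<in>UNIV. slot_coeff v h i m * slot_coeff v k m j) =
      (\<Sum>m\<in>UNIV. if m = j then (if i = j then 1 else 0) else 0)"
    by (rule sum.cong) (auto simp: slot_coeff_def Unused)
  then show ?thesis
    by (simp add: slot_coeff_def Unused)
qed (simp_all add: slot_coeff_def matrix_inv_mult assms,
    simp_all add: matrix_matrix_mult_def mult.commute)

lemma slot_coeff_mat_1: "slot_coeff v (mat 1) i j = (if i = j then 1 else 0)"
  by (cases v; simp add: slot_coeff_def; simp add: mat_def)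

text \<open>Multi-indices are functions from slots to basis indices. Expanding over them turns
  identities for single slots into identities for whole tensors.\<close>

lemma prod_sum_fun:
  fixes f :: "'s::finite \<Rightarrow> 'n::finite \<Rightarrow> real"
  shows "(\<Prod>s\<in>UNIV. \<Sum>m\<in>UNIV. f s m) = (\<Sum>L\<in>UNIV. \<Prod>s\<in>UNIV. f s (L s))"
  using prod_sum_PiE[of UNIV "\<lambda>_. UNIV" f] by simp

lemma prod_delta_fun:
  fixes I J :: "'s::finite \<Rightarrow> 'n"
  shows "(\<Prod>s\<in>UNIV. if I s = J s then 1 else (0::real)) = (if I = J then 1 else 0)"
proof (cases "I = J")
  case False
  then obtain s where "I s \<noteq> J s"
    by blast
  then show ?thesis
    using False by (auto intro!: prod_zero)
qed simp

lemma tact_nth: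
  "tact var h x $ (k, I) = (\<Sum>J\<in>UNIV. (\<Prod>s\<in>UNIV. slot_coeff (var k s) h (I s) (J s)) * x $ (k, J))"
  by (simp add: tact_def)

lemma linear_tact: "linear (tact var h)"
  by (rule linearI)
    (simp_all add: tact_def vec_eq_iff sum.distrib algebra_simps sum_distrib_left)

lemma bounded_linear_tact: "bounded_linear (tact var h)"
  using linear_tact by (simp only: linear_conv_bounded_linear)

lemma tact_mat_1 [simp]: "tact var (mat 1) x = x"
  by (auto simp: vec_eq_iff tact_nth slot_coeff_mat_1 prod_delta_fun if_distrib[of "\<lambda>x. x * _"] cong: if_cong)

lemma tact_mult:
  assumes "invertible h" "invertible k"
  shows "tact var (h ** k) x = tact var h (tact var k x)"
proof -
  have "tact var (h ** k) x $ (l, I) = tact var h (tact var k x) $ (l, I)" for l I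
  proof -
    have "tact var (h ** k) x $ (l, I) =
      (\<Sum>J\<in>UNIV. (\<Sum>L\<in>UNIV. \<Prod>s\<in>UNIV. slot_coeff (var l s) h (I s) (L s) *
          slot_coeff (var l s) k (L s) (J s)) * x $ (l, J))"
      by (simp add: tact_nth slot_coeff_mult[OF assms] prod_sum_fun)
    also have "\<dots> = (\<Sum>L\<in>UNIV. \<Sum>J\<in>UNIV. (\<Prod>s\<in>UNIV. slot_coeff (var l s) h (I s) (L s)) *
          (\<Prod>s\<in>UNIV. slot_coeff (var l s) k (L s) (J s)) * x $ (l, J))"
      by (subst sum.swap) (simp add: sum_distrib_right prod.distrib)
    also have "\<dots> = tact var h (tact var k x) $ (l, I)"
      by (simp add: tact_nth sum_distrib_left mult.assoc)
    finally show ?thesis .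
  qed
  then show ?thesis
    by (simp add: vec_eq_iff)
qed

lemma tact_matrix_inv [simp]:
  assumes "invertible h"
  shows "tact var (matrix_inv h) (tact var h x) = x" "tact var h (tact var (matrix_inv h) x) = x"
  using assms by (simp_all flip: tact_mult)

section \<open>The infinitesimal action\<close>

text \<open>The derivative of \<open>slot_coeff\<close> at the identity; the sign in the covariant
  case comes from differentiating the inverse.\<close>

definition slot_deriv :: "variance \<Rightarrow> real^'n^'n \<Rightarrow> 'n \<Rightarrow> 'n \<Rightarrow> real" where
  "slot_deriv v A i j =
     (case v of Contravariant \<Rightarrow> A $ i $ j | Covariant \<Rightarrow> - A $ j $ i | Unused \<Rightarrow> 0)"

text \<open>The Leibniz rule over slots: each summand lets \<open>A\<close> act on one slot, while
  the Kronecker factors keep the others fixed. In this form of \<theta> linearity in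
  \<open>A\<close> is visible, which the definition through the exponential hides.\<close>

definition lin_act ::
    "('k \<Rightarrow> 's \<Rightarrow> variance) \<Rightarrow> real^'n^'n \<Rightarrow> ('k::finite, 's::finite, 'n::finite) tensor
      \<Rightarrow> ('k, 's, 'n) tensor" where
  "lin_act var A x =
     (\<chi> kI. \<Sum>J\<in>UNIV. (\<Sum>s\<in>UNIV. slot_deriv (var (fst kI) s) A (snd kI s) (J s) *
        (\<Prod>r\<in>UNIV - {s}. if snd kI r = J r then 1 else 0)) * x $ (fst kI, J))"

lemma linear_lin_act: "linear (\<lambda>A::real^'n^'n. lin_act var A x)"
proof -
  have add: "slot_deriv v (A + B) i j = slot_deriv v A i j + slot_deriv v B i j"
    and scale: "slot_deriv v (c *\<^sub>R A) i j = c * slot_deriv v A i j"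
    for v A B c and i j :: 'n
    by (cases v; simp add: slot_deriv_def)+
  show ?thesis
  proof (rule linearI)
    show "lin_act var (A + B) x = lin_act var A x + lin_act var B x" for A B :: "real^'n^'n"
      by (simp add: lin_act_def vec_eq_iff add sum.distrib distrib_right)
    show "lin_act var (c *\<^sub>R A) x = c *\<^sub>R lin_act var A x" for c and A :: "real^'n^'n"
      by (simp add: lin_act_def vec_eq_iff scale mult.assoc flip: sum_distrib_left)
  qed
qed

lemma DERIV_slot_coeff:
  assumes g: "(g has_vector_derivative A) (at t)" and 1: "g t = mat 1"
  shows "((\<lambda>s. slot_coeff v (g s) i j) has_field_derivative slot_deriv v A i j) (at t)"
proof -
  have "((\<lambda>s. g s $ i $ j) has_vector_derivative A $ i $ j) (at t)"
    using g by (simp add: has_vector_derivative_vec_iff)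
  moreover have "((\<lambda>s. matrix_inv (g s) $ j $ i) has_vector_derivative - A $ j $ i) (at t)"
    using has_vector_derivative_matrix_inv[OF g] by (simp add: has_vector_derivative_vec_iff 1)
  ultimately show ?thesis
    by (cases v) (simp_all add: slot_coeff_def slot_deriv_def has_real_derivative_iff_has_vector_derivative)
qed

lemma DERIV_prod:
  fixes f :: "'i \<Rightarrow> real \<Rightarrow> real"
  assumes "\<And>i. i \<in> I \<Longrightarrow> (f i has_field_derivative f' i) (at t)"
  shows "((\<lambda>x. \<Prod>i\<in>I. f i x) has_field_derivative (\<Sum>i\<in>I. f' i * (\<Prod>j\<in>I - {i}. f j t))) (at t)"
proof -
  have "((\<lambda>x. \<Prod>i\<in>I. f i x) has_derivative (\<lambda>y. \<Sum>i\<in>I. (f' i * y) * (\<Prod>j\<in>I - {i}. f j t))) (at t)"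
    using assms by (intro has_derivative_prod) (simp add: has_field_derivative_def)
  moreover have "(\<lambda>y. \<Sum>i\<in>I. (f' i * y) * (\<Prod>j\<in>I - {i}. f j t)) =
      (*) (\<Sum>i\<in>I. f' i * (\<Prod>j\<in>I - {i}. f j t))"
    by (auto simp: fun_eq_iff sum_distrib_left mult_ac)
  ultimately show ?thesis
    by (simp add: has_field_derivative_def)
qed

text \<open>A product rule at a time when the group element is the identity, where the
  undifferentiated slots reduce to Kronecker symbols. Other times are brought to this case by
  multiplying with a fixed matrix.\<close>

lemma has_vector_derivative_tact:
  fixes g :: "real \<Rightarrow> real^'n^'n"
  assumes g: "(g has_vector_derivative A) (at t)" and 1: "g t = mat 1"
    and x: "(x has_vector_derivative x') (at t)"
  shows "((\<lambda>s. tact var (g s) (x s)) has_vector_derivative (lin_act var A (x t) + x')) (at t)"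
  unfolding has_vector_derivative_vec_iff
proof (intro allI, clarify)
  fix k I
  let ?c = "\<lambda>J r s. slot_coeff (var k r) (g s) (I r) (J r)"
  let ?d = "\<lambda>J. \<Sum>r\<in>UNIV. slot_deriv (var k r) A (I r) (J r) * (\<Prod>r'\<in>UNIV - {r}. ?c J r' t)"
  have "((\<lambda>s. \<Sum>J\<in>UNIV. (\<Prod>r\<in>UNIV. ?c J r s) * x s $ (k, J)) has_field_derivative
      (\<Sum>J\<in>UNIV. ?d J * x t $ (k, J) + x' $ (k, J) * (\<Prod>r\<in>UNIV. ?c J r t))) (at t)"
    using x by (intro DERIV_sum DERIV_mult DERIV_prod DERIV_slot_coeff[OF g 1])
      (simp add: has_vector_derivative_vec_iff has_real_derivative_iff_has_vector_derivative)
  moreover have "(\<Sum>J\<in>UNIV. ?d J * x t $ (k, J) + x' $ (k, J) * (\<Prod>r\<in>UNIV. ?c J r t)) =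
      (lin_act var A (x t) + x') $ (k, I)"
    by (simp add: 1 slot_coeff_mat_1 prod_delta_fun sum.distrib lin_act_def if_distrib[of "\<lambda>z. _ * z"]
        cong: if_cong)
  ultimately show "((\<lambda>s. tact var (g s) (x s) $ (k, I)) has_vector_derivative
      (lin_act var A (x t) + x') $ (k, I)) (at t)"
    by (simp add: tact_nth has_real_derivative_iff_has_vector_derivative)
qed

text \<open>Each entry is a real power series in \<open>t\<close> dominated by an exponential
  series. It converges everywhere, and termwise differentiation at 0 leaves the linear
  coefficient.\<close>

lemma mat_exp_has_vector_derivative:
  fixes A :: "real^'n^'n"
  shows "((\<lambda>t. mat_exp (t *\<^sub>R A)) has_vector_derivative A) (at 0)"
    and "mat_exp 0 = (mat 1 :: real^'n^'n)"
proof -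
  interpret mm: bounded_bilinear "(**) :: real^'n^'n \<Rightarrow> real^'n^'n \<Rightarrow> real^'n^'n"
    by (rule bounded_bilinear_matrix_mult)
  obtain C where C: "C > 0" "\<forall>(A :: real^'n^'n) B :: real^'n^'n. norm (A ** B) \<le> norm A * norm B * C"
    using mm.pos_bounded by (elim exE conjE) (rule that)
  define a where "a k = ((**) A ^^ k) (mat 1)" for k
  have a_le: "norm (a k) \<le> norm (mat 1 :: real^'n^'n) * (norm A * C) ^ k" for k
  proof (induction k)
    case (Suc k)
    have "norm (a (Suc k)) \<le> norm A * norm (a k) * C"
      using C(2)[rule_format, of A "a k"] by (simp add: a_def)
    also have "\<dots> \<le> norm A * (norm (mat 1 :: real^'n^'n) * (norm A * C) ^ k) * C"
      using Suc C(1) by (intro mult_right_mono mult_left_mono) auto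
    finally show ?case
      by (simp add: mult_ac)
  qed (simp add: a_def)
  have pow: "((**) (t *\<^sub>R A) ^^ k) (mat 1) = t ^ k *\<^sub>R a k" for t k
    by (induction k) (simp_all add: a_def mm.scaleR_left mm.scaleR_right)
  have term_le: "norm ((1 / fact k) *\<^sub>R t ^ k *\<^sub>R a k) \<le>
      norm (mat 1 :: real^'n^'n) * (inverse (fact k) * (\<bar>t\<bar> * (norm A * C)) ^ k)" for t :: real and k
  proof -
    have "norm ((1 / fact k) *\<^sub>R t ^ k *\<^sub>R a k) = inverse (fact k) * \<bar>t\<bar> ^ k * norm (a k)"
      by (simp add: abs_mult power_abs divide_inverse)
    also have "\<dots> \<le> inverse (fact k) * \<bar>t\<bar> ^ k * (norm (mat 1 :: real^'n^'n) * (norm A * C) ^ k)"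
      by (intro mult_left_mono a_le) auto
    finally show ?thesis
      by (simp add: power_mult_distrib mult_ac)
  qed
  have summ: "summable (\<lambda>k. (1 / fact k) *\<^sub>R t ^ k *\<^sub>R a k)" for t :: real
    by (rule summable_comparison_test'[OF _ term_le]) (intro summable_mult summable_exp)
  have nth: "mat_exp (t *\<^sub>R A) $ i $ j = (\<Sum>k. (a k $ i $ j / fact k) * t ^ k)"
    and summ_nth: "summable (\<lambda>k. (a k $ i $ j / fact k) * t ^ k)" for t i j
  proof -
    have bl: "bounded_linear (\<lambda>x::real^'n^'n. x $ i $ j)"
      by (intro bounded_linear_compose[OF bounded_linear_vec_nth] bounded_linear_vec_nth)
    have "mat_exp (t *\<^sub>R A) $ i $ j = (\<Sum>k. (1 / fact k) *\<^sub>R t ^ k *\<^sub>R a k) $ i $ j"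
      by (simp only: mat_exp_def pow)
    also have "\<dots> = (\<Sum>k. ((1 / fact k) *\<^sub>R t ^ k *\<^sub>R a k) $ i $ j)"
      by (rule bounded_linear.suminf[OF bl summ])
    finally show "mat_exp (t *\<^sub>R A) $ i $ j = (\<Sum>k. (a k $ i $ j / fact k) * t ^ k)"
      by (simp add: mult_ac)
    show "summable (\<lambda>k. (a k $ i $ j / fact k) * t ^ k)"
      using bounded_linear.summable[OF bl summ[of t]] by (simp add: mult_ac)
  qed
  show "((\<lambda>t. mat_exp (t *\<^sub>R A)) has_vector_derivative A) (at 0)"
    unfolding has_vector_derivative_vec_iff
  proof (intro allI)
    fix i j
    have "((\<lambda>t. \<Sum>k. (a k $ i $ j / fact k) * t ^ k) has_field_derivative
        (\<Sum>k. diffs (\<lambda>k. a k $ i $ j / fact k) k * 0 ^ k)) (at 0)"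
      by (rule termdiffs_strong_converges_everywhere) (rule summ_nth)
    moreover have "(\<Sum>k. diffs (\<lambda>k. a k $ i $ j / fact k) k * 0 ^ k) = A $ i $ j"
      by (simp only: powser_zero) (simp add: diffs_def a_def)
    ultimately show "((\<lambda>t. mat_exp (t *\<^sub>R A) $ i $ j) has_vector_derivative A $ i $ j) (at 0)"
      by (simp add: nth has_real_derivative_iff_has_vector_derivative)
  qed
  have "mat_exp (0 *\<^sub>R A) $ i $ j = (mat 1 :: real^'n^'n) $ i $ j" for i j
    unfolding nth powser_zero by (simp add: a_def)
  then show "mat_exp 0 = (mat 1 :: real^'n^'n)"
    by (simp add: vec_eq_iff)
qed

text \<open>The exponential curve passes through the identity with velocity \<open>A\<close>, and
  only this first-order datum enters the derivative.\<close>

lemma inf_act_eq_lin_act: "inf_act var A x = lin_act var A x"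
  using has_vector_derivative_tact[OF mat_exp_has_vector_derivative(1), of A "\<lambda>_. x" 0 var]
  by (simp add: inf_act_def mat_exp_has_vector_derivative(2) vector_derivative_at)

text \<open>Equivariance of \<theta>, obtained by differentiating the group identity h g(s) = (h
  g(s) h^-1) h along a curve \<open>g\<close> through the identity with velocity
  \<open>A\<close>.\<close>

lemma tact_lin_act:
  fixes h A :: "real^'n^'n"
  assumes h: "invertible h"
  shows "tact var h (lin_act var A x) = lin_act var (h ** A ** matrix_inv h) (tact var h x)"
proof -
  interpret mm: bounded_bilinear "(**) :: real^'n^'n \<Rightarrow> real^'n^'n \<Rightarrow> real^'n^'n"
    by (rule bounded_bilinear_matrix_mult)
  \<comment> \<open>A straight line has the same velocity as the exponential. It may leave the
    invertible matrices away from 0, so the two transported curves are compared near 0.\<close>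
  define g where "g s = mat 1 + s *\<^sub>R A" for s :: real
  have g0: "g 0 = mat 1"
    by (simp add: g_def)
  have g: "(g has_vector_derivative A) (at 0)"
    unfolding g_def by (auto intro!: derivative_eq_intros)
  have "((\<lambda>s. h ** g s ** matrix_inv h) has_vector_derivative h ** A ** matrix_inv h) (at 0)"
    by (intro bounded_linear.has_vector_derivative[OF mm.bounded_linear_left]
        bounded_linear.has_vector_derivative[OF mm.bounded_linear_right] g)
  from has_vector_derivative_tact[OF this, of "\<lambda>_. tact var h x" 0 var]
  have 1: "((\<lambda>s. tact var (h ** g s ** matrix_inv h) (tact var h x)) has_vector_derivative
      lin_act var (h ** A ** matrix_inv h) (tact var h x)) (at 0)"
    by (simp add: g0 h)
  have "((\<lambda>s. tact var (g s) x) has_vector_derivative lin_act var A x) (at 0)"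
    using has_vector_derivative_tact[OF g g0, of "\<lambda>_. x" 0 var] by simp
  then have 2: "((\<lambda>s. tact var h (tact var (g s) x)) has_vector_derivative
      tact var h (lin_act var A x)) (at 0)"
    by (rule bounded_linear.has_vector_derivative[OF bounded_linear_tact])
  have "\<forall>\<^sub>F s in nhds 0. det (g s) \<noteq> 0"
  proof -
    have "isCont g 0"
      using g by (rule has_vector_derivative_continuous)
    then have "(g \<longlongrightarrow> g 0) (nhds 0)"
      by (simp add: isCont_def tendsto_at_iff_tendsto_nhds)
    from tendsto_imp_eventually_ne[OF tendsto_det[OF this]] show ?thesis
      by (simp add: g0)
  qed
  then have ev: "\<forall>\<^sub>F s in nhds 0. tact var h (tact var (g s) x) =
      tact var (h ** g s ** matrix_inv h) (tact var h x)"
  proof eventually_elim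
    case (elim s)
    then have "invertible (g s)"
      by (simp add: invertible_det_nz)
    then show ?case
      using h by (simp add: tact_mult invertible_mult)
  qed
  have "((\<lambda>s. tact var (h ** g s ** matrix_inv h) (tact var h x)) has_vector_derivative
      tact var h (lin_act var A x)) (at 0)"
    using 2 unfolding has_vector_derivative_def
  proof (rule has_derivative_transform_eventually)
    show "\<forall>\<^sub>F s in at 0. tact var h (tact var (g s) x) =
        tact var (h ** g s ** matrix_inv h) (tact var h x)"
      using ev by (simp only: eventually_nhds_conv_at)
    show "tact var h (tact var (g 0) x) = tact var (h ** g 0 ** matrix_inv h) (tact var h x)"
      using ev by (rule eventually_nhds_x_imp_x)
  qed simp
  from vector_derivative_unique_at[OF this 1] show ?thesis .
qed

section \<open>Norms induced by inner products\<close>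

text \<open>\<open>P\<close> sends a vector to its coordinates in an orthonormal basis for
  \<open>ip\<close>. Such a basis is found as an orthonormal set of largest cardinality.\<close>

lemma inner_product_eq_inner:
  fixes ip :: "real^'n \<Rightarrow> real^'n \<Rightarrow> real"
  assumes ip: "inner_product ip"
  obtains P :: "real^'n^'n" where "invertible P" "\<And>v w. ip v w = (P *v v) \<bullet> (P *v w)"
proof -
  have bil: "bilinear ip" and sym: "ip v w = ip w v" and pos: "v \<noteq> 0 \<Longrightarrow> ip v v > 0" for v w
    using ip by (auto simp: inner_product_def)
  note simps = bilinear_ladd[OF bil] bilinear_radd[OF bil] bilinear_lmul[OF bil]
    bilinear_rmul[OF bil] bilinear_lsub[OF bil] bilinear_rsub[OF bil] bilinear_lzero[OF bil]
    bilinear_rzero[OF bil]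
  have suml: "ip (sum f B) w = (\<Sum>b\<in>B. ip (f b) w)" for f :: "real^'n \<Rightarrow> real^'n" and B w
    using bil by (intro linear_sum) (simp add: bilinear_def)
  define ON where "ON B \<longleftrightarrow> finite B \<and> (\<forall>b\<in>B. \<forall>c\<in>B. ip b c = (if b = c then 1 else 0))"
    for B
  have ON_coeff: "ip (\<Sum>b\<in>B. f b *\<^sub>R b) c = f c" if "ON B" "c \<in> B" for f B c
  proof -
    have "ip (\<Sum>b\<in>B. f b *\<^sub>R b) c = (\<Sum>b\<in>B. if b = c then f c else 0)"
      unfolding suml using that by (intro sum.cong) (auto simp: ON_def simps)
    then show ?thesis
      using that by (simp add: ON_def)
  qed
  have ON_indep: "independent B" if "ON B" for B
  proof (rule independent_if_scalars_zero)
    show "finite B"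
      using that by (simp add: ON_def)
    show "f x = 0" if "(\<Sum>x\<in>B. f x *\<^sub>R x) = 0" "x \<in> B" for f x
      using ON_coeff[OF \<open>ON B\<close> that(2), of f] by (simp add: that(1) simps)
  qed
  \<comment> \<open>Orthonormal sets are independent, so their cardinality is bounded by the
    dimension and a largest one exists.\<close>
  have "\<exists>B. ON B \<and> (\<forall>C. ON C \<longrightarrow> card C \<le> card B)"
  proof (rule ex_has_greatest_nat[of ON "{}" card "Suc CARD('n)"])
    show "ON {}"
      by (simp add: ON_def)
    show "\<forall>C. ON C \<longrightarrow> card C < Suc CARD('n)"
      using ON_indep independent_card_le[where 'a = "real^'n"] by (auto simp: less_Suc_eq_le)
  qed
  then obtain B where B: "ON B" and B_max: "\<And>C. ON C \<Longrightarrow> card C \<le> card B"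
    by blast
  \<comment> \<open>A nonzero remainder of \<open>v\<close> after subtracting its projection is
    orthogonal to \<open>B\<close>; its normalization could be added to \<open>B\<close>, against
    maximality.\<close>
  have expand: "v = (\<Sum>b\<in>B. ip v b *\<^sub>R b)" for v
  proof (rule ccontr)
    define x where "x = v - (\<Sum>b\<in>B. ip v b *\<^sub>R b)"
    assume "v \<noteq> (\<Sum>b\<in>B. ip v b *\<^sub>R b)"
    then have "ip x x > 0"
      by (intro pos) (simp add: x_def)
    define y where "y = (1 / sqrt (ip x x)) *\<^sub>R x"
    have "ip y y = 1"
      using \<open>ip x x > 0\<close> by (simp add: y_def simps)
    moreover have "ip y b = 0" "ip b y = 0" if "b \<in> B" for b
      using ON_coeff[OF B that, of "ip v"] sym[of b y] by (simp_all add: y_def x_def simps)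
    ultimately have "ON (insert y B)" "y \<notin> B"
      using B by (auto simp: ON_def)
    then show False
      using B_max[of "insert y B"] B by (simp add: ON_def)
  qed
  have "v \<in> span B" for v
    by (subst expand) (intro span_sum span_scale span_base)
  then have "span B = UNIV"
    by blast
  then have "card B = CARD('n)"
    using dim_span_eq_card_independent[OF ON_indep[OF B]] by simp
  then obtain \<beta> :: "'n \<Rightarrow> real^'n" where \<beta>: "bij_betw \<beta> UNIV B"
    using B by (metis ON_def finite bij_betw_iff_card)
  define f where "f v = (\<chi> i. ip v (\<beta> i))" for v
  have "linear f"
    by (rule linearI) (simp_all add: f_def vec_eq_iff simps)
  have ff: "f v \<bullet> f w = ip v w" for v w
  proof -
    have "f v \<bullet> f w = (\<Sum>b\<in>B. ip v b * ip w b)"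
      using sum.reindex_bij_betw[OF \<beta>, of "\<lambda>b. ip v b * ip w b"] by (simp add: f_def inner_vec_def)
    also have "\<dots> = ip (\<Sum>b\<in>B. ip v b *\<^sub>R b) w"
      unfolding suml by (intro sum.cong) (auto simp: simps sym)
    finally show ?thesis
      using expand by simp
  qed
  have "inj f"
    unfolding linear_injective_0[OF \<open>linear f\<close>]
    using ff pos by (metis inner_zero_left less_irrefl)
  then have "invertible (matrix f)"
    using \<open>linear f\<close> by (simp add: invertible_left_inverse matrix_left_invertible_injective)
  then show thesis
    using that[of "matrix f"] ff \<open>linear f\<close> by simp
qed

text \<open>The inverse of P^T P is P^-1 P^-T. Thus in each variance the slot metric is the
  Kronecker metric pulled back by the slot action of \<open>P\<close>.\<close>

lemma slot_metric_transpose_mult: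
  fixes P :: "real^'n^'n"
  assumes P: "invertible P"
  shows "slot_metric v (transpose P ** P) i j =
    (\<Sum>m\<in>UNIV. slot_coeff v P m i * slot_coeff v P m j)"
proof (cases v)
  case Contravariant
  then show ?thesis
    by (simp add: slot_metric_def slot_coeff_def matrix_matrix_mult_def transpose_def)
next
  case Covariant
  have "transpose P ** transpose (matrix_inv P) = mat 1"
    using P by (simp add: transpose_mat flip: matrix_transpose_mul)
  moreover from this have "invertible (transpose P)"
    using invertible_right_inverse by blast
  ultimately have "matrix_inv (transpose P) = transpose (matrix_inv P)" "invertible (transpose P)"
    using P by (auto simp: matrix_inv_unique)
  then have "matrix_inv (transpose P ** P) = matrix_inv P ** transpose (matrix_inv P)"
    using P by (simp add: matrix_inv_mult)
  with Covariant show ?thesis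
    by (simp only: slot_metric_def slot_coeff_def variance.case)
      (simp add: matrix_matrix_mult_def transpose_def)
next
  case Unused
  have "(\<Sum>m\<in>UNIV. slot_coeff v P m i * slot_coeff v P m j) =
      (\<Sum>m\<in>UNIV. if m = i then (if i = j then 1 else 0) else 0)"
    by (rule sum.cong) (auto simp: slot_coeff_def Unused)
  then show ?thesis
    by (simp add: slot_metric_def Unused)
qed

text \<open>\<open>P\<close> is an isometry from \<open>b\<close> to the standard inner product,
  hence carries the norm induced by \<open>b\<close> to the euclidean norm of the components. This
  replaces the moving norms of the flow by one fixed norm.\<close>

lemma tensor_norm_eq_norm_tact:
  fixes P :: "real^'n^'n"
  assumes P: "invertible P" and b: "\<And>v w. b v w = (P *v v) \<bullet> (P *v w)"
  shows "tensor_norm var b x = norm (tact var P x)"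
proof -
  have gram: "gram b = transpose P ** P"
    by (simp add: gram_def b vec_eq_iff matrix_vector_mult_basis column_def inner_vec_def
        matrix_matrix_mult_def transpose_def)
  let ?c = "\<lambda>k L I. \<Prod>s\<in>UNIV. slot_coeff (var k s) P (L s) (I s)"
  have "(\<Sum>I\<in>UNIV. \<Sum>J\<in>UNIV. (\<Prod>s\<in>UNIV. slot_metric (var k s) (gram b) (I s) (J s)) *
      x $ (k, I) * x $ (k, J)) = (\<Sum>L\<in>UNIV. (tact var P x $ (k, L))\<^sup>2)" for k
  proof -
    have "(\<Sum>I\<in>UNIV. \<Sum>J\<in>UNIV. (\<Prod>s\<in>UNIV. slot_metric (var k s) (gram b) (I s) (J s)) *
        x $ (k, I) * x $ (k, J)) =
        (\<Sum>I\<in>UNIV. \<Sum>J\<in>UNIV. \<Sum>L\<in>UNIV. (?c k L I * x $ (k, I)) * (?c k L J * x $ (k, J)))"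
      by (simp add: gram slot_metric_transpose_mult[OF P] prod_sum_fun prod.distrib
          sum_distrib_right sum_distrib_left mult_ac)
    also have "\<dots> = (\<Sum>I\<in>UNIV. \<Sum>L\<in>UNIV. \<Sum>J\<in>UNIV. (?c k L I * x $ (k, I)) * (?c k L J * x $ (k, J)))"
      by (intro sum.cong refl sum.swap)
    also have "\<dots> = (\<Sum>L\<in>UNIV. \<Sum>I\<in>UNIV. \<Sum>J\<in>UNIV. (?c k L I * x $ (k, I)) * (?c k L J * x $ (k, J)))"
      by (rule sum.swap)
    also have "\<dots> = (\<Sum>L\<in>UNIV. (tact var P x $ (k, L))\<^sup>2)"
      by (simp add: tact_nth power2_eq_square sum_product)
    finally show ?thesis .
  qed
  then show ?thesis
    by (simp add: tensor_norm_def norm_eq_sqrt_inner inner_vec_def power2_eq_square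
        sum.cartesian_product case_prod_unfold)
qed

section \<open>Ordinary differential equations\<close>

text \<open>The continuous first derivatives, evaluated on a basis, are bounded on the compact ball
  and bound the operator norm; the mean value inequality on the convex ball does the rest.\<close>

lemma smooth_on_lipschitz_cball:
  fixes f :: "'a::euclidean_space \<Rightarrow> 'b::euclidean_space"
  assumes "smooth_on N f" "cball x r \<subseteq> N"
  obtains L where "L \<ge> 0" "\<And>y z. y \<in> cball x r \<Longrightarrow> z \<in> cball x r \<Longrightarrow> norm (f y - f z) \<le> L * norm (y - z)"
proof -
  let ?D = "\<lambda>y. frechet_derivative f (at y)"
  have "Ck_on (Suc 0) N f"
    using assms(1) by (simp only: smooth_on_def)
  then have diff: "\<And>y. y \<in> N \<Longrightarrow> f differentiable (at y)"
    and cont: "\<And>v. continuous_on N (\<lambda>y. ?D y v)"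
    by auto
  have "compact ((\<lambda>y. \<Sum>i\<in>Basis. norm (?D y i)) ` cball x r)"
    by (intro compact_continuous_image continuous_intros continuous_on_subset[OF cont assms(2)]) auto
  then obtain L where "\<forall>y\<in>cball x r. norm (\<Sum>i\<in>Basis. norm (?D y i)) \<le> L"
    by (fastforce dest!: compact_imp_bounded simp: bounded_iff)
  then have L: "(\<Sum>i\<in>Basis. norm (?D y i)) \<le> L" if "y \<in> cball x r" for y
    using that by fastforce
  \<comment> \<open>An empty ball allows a negative \<open>L\<close>, hence the maximum with
    0.\<close>
  have "norm (f y - f z) \<le> max L 0 * norm (y - z)" if yz: "y \<in> cball x r" "z \<in> cball x r" for y z
  proof (rule differentiable_bound[OF convex_cball _ _ yz(1) yz(2)])
    fix w assume w: "w \<in> cball x r"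
    then have D: "(f has_derivative ?D w) (at w)"
      using diff assms(2) frechet_derivative_works by blast
    then show "(f has_derivative ?D w) (at w within cball x r)"
      by (rule has_derivative_at_withinI)
    have "onorm (?D w) \<le> (\<Sum>i\<in>Basis. norm (?D w i))"
      using D by (intro onorm_componentwise) (rule has_derivative_bounded_linear)
    then show "onorm (?D w) \<le> max L 0"
      using L[OF w] by simp
  qed
  then show thesis
    using that[of "max L 0"] by simp
qed

text \<open>A local smooth extension is Lipschitz on a small ball, and the field agrees with it on
  the part of the ball inside \<open>U\<close>.\<close>

lemma smooth_vector_field_local_lipschitz:
  assumes "smooth_vector_field W U X"
  shows "local_lipschitz (UNIV :: real set) U (\<lambda>_. X)"
proof (rule local_lipschitzI)
  fix t :: real and x assume "x \<in> U"
  then obtain N f where N: "open N" "x \<in> N" "smooth_on N f" "\<forall>y\<in>N \<inter> U. f y = X y"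
    using assms unfolding smooth_vector_field_def by metis
  then obtain r where r: "r > 0" "cball x r \<subseteq> N"
    by (meson open_contains_cball)
  obtain L where L: "L \<ge> 0"
    "\<And>y z. y \<in> cball x r \<Longrightarrow> z \<in> cball x r \<Longrightarrow> norm (f y - f z) \<le> L * norm (y - z)"
    using smooth_on_lipschitz_cball[OF N(3) r(2)] by blast
  have "L-lipschitz_on (cball x r \<inter> U) X"
  proof (rule lipschitz_onI[OF _ L(1)])
    fix y z assume "y \<in> cball x r \<inter> U" "z \<in> cball x r \<inter> U"
    moreover from this have "f y = X y" "f z = X z"
      using N(4) r(2) by auto
    ultimately show "dist (X y) (X z) \<le> L * dist y z"
      using L(2)[of y z] by (simp add: dist_norm)
  qed
  then show "\<exists>u>0. \<exists>L. \<forall>t\<in>cball t u \<inter> UNIV. L-lipschitz_on (cball x u \<inter> U) X"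
    using r(1) by blast
qed

text \<open>The Picard operator contracts with factor \<open>T * L\<close> in the supremum norm. It
  acts on the bounded continuous functions on the whole line, a complete space.\<close>

lemma picard_lindelof_lipschitz:
  fixes g :: "'a::euclidean_space \<Rightarrow> 'a"
  assumes lip: "\<And>y z. norm (g y - g z) \<le> L * norm (y - z)"
    and T: "0 \<le> T" "T * L < 1" and L: "0 \<le> L"
  obtains u where "continuous_on {0..T} u"
    "\<And>t. t \<in> {0..T} \<Longrightarrow> u t = x0 + integral {0..t} (\<lambda>s. g (u s))"
proof -
  \<comment> \<open>Clamping time to \<open>{0..T}\<close> extends a continuous function on the
    interval to a bounded one on the line, constant beyond the ends.\<close>
  define cl where "cl t = max 0 (min T t)" for t
  have cl: "cl t \<in> {0..T}" for t
    using T by (auto simp: cl_def)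
  define I where "I u t = x0 + integral {0..t} (\<lambda>s. g (apply_bcontfun u s))"
    for u :: "real \<Rightarrow>\<^sub>C 'a" and t
  have "L-lipschitz_on UNIV g"
    using lip L by (auto simp: lipschitz_on_def dist_norm)
  then have g_cont: "continuous_on UNIV g"
    by (rule lipschitz_on_continuous_on)
  have gu_cont: "continuous_on S (\<lambda>s. g (apply_bcontfun u s))" for u S
    by (rule continuous_on_compose2[OF g_cont]) auto
  have I_cont: "continuous_on {0..T} (I u)" for u
    unfolding I_def
    by (intro continuous_intros indefinite_integral_continuous_1 integrable_continuous_real gu_cont)
  have mem: "(\<lambda>t. I u (cl t)) \<in> bcontfun" for u
    unfolding bcontfun_def
  proof (intro CollectI conjI)
    show "continuous_on UNIV (\<lambda>t. I u (cl t))"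
      by (rule continuous_on_compose2[OF I_cont]) (use cl in \<open>auto simp: cl_def intro!: continuous_intros\<close>)
    have "bounded (I u ` {0..T})"
      by (intro compact_imp_bounded compact_continuous_image I_cont) auto
    then show "bounded (range (\<lambda>t. I u (cl t)))"
      by (rule bounded_subset) (use cl in auto)
  qed
  define \<Phi> where "\<Phi> u = Bcontfun (\<lambda>t. I u (cl t))" for u
  have \<Phi>: "apply_bcontfun (\<Phi> u) t = I u (cl t)" for u t
    unfolding \<Phi>_def by (simp add: Bcontfun_inverse mem)
  have "\<exists>!u. \<Phi> u = u"
  proof (rule banach_fix_type)
    show "\<forall>u v. dist (\<Phi> u) (\<Phi> v) \<le> (T * L) * dist u v"
    proof (intro allI dist_bound)
      fix u v t
      have "norm (integral {0..cl t} (\<lambda>s. g (apply_bcontfun u s) - g (apply_bcontfun v s))) \<le>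
          (L * dist u v) * (cl t - 0)"
      proof (rule integral_bound)
        show "norm (g (apply_bcontfun u s) - g (apply_bcontfun v s)) \<le> L * dist u v" for s
          using dist_bounded[of u s v] L
          by (intro order_trans[OF lip] mult_left_mono) (simp_all add: dist_norm)
      qed (use cl in \<open>auto intro!: continuous_intros gu_cont\<close>)
      also have "\<dots> \<le> (L * dist u v) * T"
        using cl[of t] L by (intro mult_left_mono) auto
      finally show "dist (apply_bcontfun (\<Phi> u) t) (apply_bcontfun (\<Phi> v) t) \<le> T * L * dist u v"
        by (simp add: \<Phi> I_def dist_norm mult_ac integral_diff integrable_continuous_real gu_cont)
    qed
  qed (use T L in auto)
  then obtain u where u: "\<Phi> u = u"
    by blast
  show thesis
  proof (rule that)
    show "continuous_on {0..T} (apply_bcontfun u)"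
      by simp
    show "apply_bcontfun u t = x0 + integral {0..t} (\<lambda>s. g (apply_bcontfun u s))"
      if "t \<in> {0..T}" for t
      using \<Phi>[of u t] that by (simp add: u cl_def I_def)
  qed
qed

text \<open>Pairing with a vector of the orthogonal complement commutes with the integral and gives
  0; a subspace is its own double complement.\<close>

lemma integral_in_subspace:
  fixes f :: "real \<Rightarrow> 'a::euclidean_space"
  assumes W: "subspace W" and f: "f integrable_on S" "\<And>s. s \<in> S \<Longrightarrow> f s \<in> W"
  shows "integral S f \<in> W"
proof -
  have "orthogonal y (integral S f)" if "y \<in> orthogonal_comp W" for y
  proof -
    have "y \<bullet> integral S f = integral S (\<lambda>s. y \<bullet> f s)"
      using integral_linear[OF f(1) bounded_linear_inner_right[of y]] by (simp add: o_def)
    also have "\<dots> = integral S (\<lambda>s. 0)"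
      using that f(2) by (intro integral_cong) (auto simp: orthogonal_comp_def orthogonal_def inner_commute)
    finally show ?thesis
      by (simp add: orthogonal_def)
  qed
  then have "integral S f \<in> orthogonal_comp (orthogonal_comp W)"
    by (auto simp: orthogonal_comp_def)
  then show ?thesis
    using orthogonal_comp_self[OF W] by simp
qed

text \<open>Composing the field with the nearest-point projection onto \<open>W \<inter> cball x0 r\<close> makes it globally
  Lipschitz, and the solution of the modified equation stays where the projection is the identity.\<close>

lemma local_solution_exists:
  fixes X :: "'a::euclidean_space \<Rightarrow> 'a"
  assumes W: "subspace W" and U: "openin (top_of_set W) U"
    and X: "\<And>x. x \<in> U \<Longrightarrow> X x \<in> W" "local_lipschitz (UNIV :: real set) U (\<lambda>_. X)" and x0: "x0 \<in> U"
  shows "\<exists>e>0. \<exists>u :: real \<Rightarrow> 'a. continuous_on {0..e} u \<and> u 0 = x0 \<and>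
    (\<forall>t\<in>{0..e}. u t \<in> U \<and> u t = x0 + integral {0..t} (\<lambda>s. X (u s)))"
proof -
  obtain V where V: "open V" "U = W \<inter> V"
    using U by (meson openin_open)
  then obtain r1 where r1: "r1 > 0" "cball x0 r1 \<subseteq> V"
    using x0 open_contains_cball by blast
  obtain r2 L where r2: "r2 > 0" and lip2: "L-lipschitz_on (cball x0 r2 \<inter> U) X"
    using local_lipschitzE[OF X(2) UNIV_I x0] by (metis IntI UNIV_I centre_in_cball less_imp_le)
  define r where "r = min r1 r2"
  have r: "r > 0" "cball x0 r \<subseteq> V" "cball x0 r \<subseteq> cball x0 r2"
    using r1 r2 by (auto simp: r_def)
  define C where "C = W \<inter> cball x0 r"
  have C: "closed C" "convex C" "C \<noteq> {}" "x0 \<in> C"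
    using W x0 V r
    by (auto simp: C_def closed_Int convex_Int closed_subspace subspace_imp_convex)
  have CU: "C \<subseteq> U" "C \<subseteq> cball x0 r"
    using r V by (auto simp: C_def)
  then have lip: "L-lipschitz_on C X"
    using r(3) by (intro lipschitz_on_subset[OF lip2]) auto
  then have L: "L \<ge> 0"
    by (rule lipschitz_on_nonneg)
  define p where "p = closest_point C"
  have p: "p y \<in> C" "norm (p y - p z) \<le> norm (y - z)" for y z
    using closest_point_in_set[OF C(1,3)] closest_point_lipschitz[OF C(2,1,3)]
    by (auto simp: p_def dist_norm)
  define g where "g y = X (p y)" for y
  have gW: "g y \<in> W" for y
    using X(1) CU(1) p(1)[of y] by (auto simp: g_def)
  have g_lip: "norm (g y - g z) \<le> L * norm (y - z)" for y z
  proof -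
    have "norm (g y - g z) \<le> L * norm (p y - p z)"
      unfolding g_def using lipschitz_onD[OF lip p(1) p(1)] by (simp add: dist_norm)
    also have "\<dots> \<le> L * norm (y - z)"
      using L p(2) by (intro mult_left_mono) auto
    finally show ?thesis .
  qed
  \<comment> \<open>A bound for \<open>g\<close> on the whole space, since the projected point
    always lies within \<open>r\<close> of \<open>x0\<close>.\<close>
  define B where "B = norm (X x0) + L * r"
  have B: "norm (g y) \<le> B" for y
  proof -
    have "norm (X (p y) - X x0) \<le> L * norm (p y - x0)"
      using lipschitz_onD[OF lip p(1) C(4)] by (simp add: dist_norm)
    also have "\<dots> \<le> L * r"
      using L CU p(1)[of y] by (intro mult_left_mono) (auto simp: dist_norm norm_minus_commute)
    finally show ?thesis
      unfolding g_def B_def using norm_triangle_sub[of "X (p y)" "X x0"] by linarith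
  qed
  have "B \<ge> 0"
    using B[of 0] norm_ge_zero order_trans by blast
  \<comment> \<open>The first term makes the Picard operator contract; the second keeps the solution
    within \<open>r\<close> of \<open>x0\<close>. Adding 1 avoids division by 0.\<close>
  define e where "e = min (1 / (2 * (L + 1))) (r / (B + 1))"
  have e: "e > 0" "e * L < 1" "B * e \<le> r"
  proof -
    show "e > 0"
      using L r \<open>B \<ge> 0\<close> by (simp add: e_def)
    have "e * L \<le> 1 / (2 * (L + 1)) * L"
      using L by (intro mult_right_mono) (auto simp: e_def)
    also have "\<dots> < 1"
      using L by (simp add: field_simps)
    finally show "e * L < 1" .
    have "B * e \<le> B * (r / (B + 1))"
      using \<open>B \<ge> 0\<close> by (intro mult_left_mono) (auto simp: e_def)
    also have "\<dots> \<le> r"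
      using \<open>B \<ge> 0\<close> r by (simp add: field_simps)
    finally show "B * e \<le> r" .
  qed
  obtain u where u: "continuous_on {0..e} u"
    "\<And>t. t \<in> {0..e} \<Longrightarrow> u t = x0 + integral {0..t} (\<lambda>s. g (u s))"
    using picard_lindelof_lipschitz[OF g_lip _ e(2) L, of x0] e(1) by (metis less_imp_le)
  have g_cont: "continuous_on UNIV g"
  proof (rule lipschitz_on_continuous_on)
    show "L-lipschitz_on UNIV g"
      using g_lip L by (auto simp: lipschitz_on_def dist_norm)
  qed
  have gu_cont: "continuous_on {0..t} (\<lambda>s. g (u s))" if "t \<in> {0..e}" for t
    by (rule continuous_on_compose2[OF g_cont]) (use that u(1) in \<open>auto intro: continuous_on_subset\<close>)
  \<comment> \<open>Bounded speed keeps \<open>u\<close> in the ball, and integrating values in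
    \<open>W\<close> keeps it in \<open>W\<close>; on \<open>C\<close> the projection is the
    identity.\<close>
  have uC: "u t \<in> C" if t: "t \<in> {0..e}" for t
  proof -
    have "norm (integral {0..t} (\<lambda>s. g (u s))) \<le> B * (t - 0)"
      using t B by (intro integral_bound gu_cont) auto
    also have "\<dots> \<le> B * e"
      using t \<open>B \<ge> 0\<close> by (intro mult_left_mono) auto
    finally have "norm (integral {0..t} (\<lambda>s. g (u s))) \<le> r"
      using e by simp
    moreover have "integral {0..t} (\<lambda>s. g (u s)) \<in> W"
      by (intro integral_in_subspace[OF W] integrable_continuous_real gu_cont t gW)
    moreover have "x0 \<in> W"
      using x0 V by auto
    ultimately show ?thesis
      using W by (auto simp: C_def u(2)[OF t] dist_norm intro: subspace_add)
  qed
  have gu: "g (u t) = X (u t)" if "t \<in> {0..e}" for t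
    using uC[OF that] by (simp add: g_def p_def closest_point_self)
  have "u t = x0 + integral {0..t} (\<lambda>s. X (u s))" if "t \<in> {0..e}" for t
  proof -
    have "integral {0..t} (\<lambda>s. g (u s)) = integral {0..t} (\<lambda>s. X (u s))"
      by (rule integral_cong) (use that gu in auto)
    then show ?thesis
      using u(2)[OF that] by simp
  qed
  moreover have "u 0 = x0"
    using u(2)[of 0] e(1) by simp
  ultimately show ?thesis
    using e(1) u(1) uC CU by (intro exI[of _ e] conjI exI[of _ u]) auto
qed

text \<open>The solution is glued to the local solution starting at its limit \<open>x0\<close>. The
  glued curve is continuous at \<open>b\<close>, so it satisfies the integral equation across
  \<open>b\<close>, and this gives the derivative there.\<close>

lemma ode_solution_extends:
  fixes X :: "'a::euclidean_space \<Rightarrow> 'a" and b :: real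
  assumes W: "subspace W" and U: "openin (top_of_set W) U"
    and X: "\<And>x. x \<in> U \<Longrightarrow> X x \<in> W" "local_lipschitz (UNIV :: real set) U (\<lambda>_. X)"
    and sol: "ode_solution U X a b \<gamma>" and ab: "a < b"
    and lim: "(\<gamma> \<longlongrightarrow> x0) (at_left b)" and x0: "x0 \<in> U"
  obtains b' \<delta> where "b < b'" "ode_solution U X a (ereal b') \<delta>"
    "\<And>t. t \<in> ereal_interval a b \<Longrightarrow> \<delta> t = \<gamma> t"
proof -
  obtain e and u :: "real \<Rightarrow> 'a" where e: "e > 0" and u_cont: "continuous_on {0..e} u" and u0: "u 0 = x0"
    and "\<forall>t\<in>{0..e}. u t \<in> U \<and> u t = x0 + integral {0..t} (\<lambda>s. X (u s))"
    using local_solution_exists[OF W U X x0] by blast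
  then have uU: "\<And>t. t \<in> {0..e} \<Longrightarrow> u t \<in> U"
    and u: "\<And>t. t \<in> {0..e} \<Longrightarrow> u t = x0 + integral {0..t} (\<lambda>s. X (u s))"
    by blast+
  have X_cont: "continuous_on U X"
    using local_lipschitz_continuous_on[OF X(2)] by simp
  define \<delta> where "\<delta> t = (if t < b then \<gamma> t else u (t - b))" for t
  have \<gamma>: "\<gamma> t \<in> U" "(\<gamma> has_vector_derivative X (\<gamma> t)) (at t)" if "a < ereal t" "t < b" for t
    using sol that by (auto simp: ode_solution_def ereal_interval_def)
  have \<delta>U: "\<delta> t \<in> U" if "a < ereal t" "t \<le> b + e" for t
    using that \<gamma> uU by (auto simp: \<delta>_def)
  have \<delta>_left: "(\<delta> has_vector_derivative X (\<delta> t)) (at t)" if "a < ereal t" "t < b" for t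
  proof -
    have "(\<delta> has_vector_derivative X (\<gamma> t)) (at t)"
      by (rule has_vector_derivative_transform_within_open[OF \<gamma>(2)[OF that] open_lessThan[of b]])
        (use that in \<open>auto simp: \<delta>_def\<close>)
    then show ?thesis
      using that by (simp add: \<delta>_def)
  qed
  have \<delta>_right: "(\<delta> has_vector_derivative X (\<delta> t)) (at t)" if t: "b < t" "t < b + e" for t
  proof -
    have "((\<lambda>s. integral {0..s} (\<lambda>s. X (u s))) has_vector_derivative X (u (t - b))) (at (t - b) within {0..e})"
      using t by (intro integral_has_vector_derivative continuous_on_compose2[OF X_cont u_cont])
        (use uU in auto)
    then have "((\<lambda>s. integral {0..s} (\<lambda>s. X (u s))) has_vector_derivative X (u (t - b))) (at (t - b))"
      using t by (simp add: at_within_Icc_at)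
    then have "((\<lambda>s. x0 + integral {0..s} (\<lambda>s. X (u s))) has_vector_derivative X (u (t - b))) (at (t - b))"
      by (auto intro!: derivative_eq_intros)
    then have "(u has_vector_derivative X (u (t - b))) (at (t - b))"
      by (rule has_vector_derivative_transform_within_open[of _ _ _ "{0<..<e}"])
        (use t in \<open>auto simp flip: u\<close>)
    then have "((u \<circ> (\<lambda>s. s - b)) has_vector_derivative 1 *\<^sub>R X (u (t - b))) (at t)"
      by (intro vector_diff_chain_at) (auto intro!: derivative_eq_intros)
    then have "((u \<circ> (\<lambda>s. s - b)) has_vector_derivative X (u (t - b))) (at t)"
      by simp
    then have "(\<delta> has_vector_derivative X (u (t - b))) (at t)"
      by (rule has_vector_derivative_transform_within_open[OF _ open_greaterThan[of b]])
        (use t in \<open>auto simp: \<delta>_def\<close>)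
    then show ?thesis
      using t by (simp add: \<delta>_def)
  qed
  \<comment> \<open>A finite base point for the integral equation, since \<open>a\<close> may be
    minus infinity.\<close>
  obtain t0 where t0: "a < ereal t0" "t0 < b"
    using ereal_dense3[OF ab] by (auto simp: less_ereal.simps)
  have deriv: "(\<delta> has_vector_derivative X (\<delta> t)) (at t)" if "t0 < t" "t < b + e" "t \<noteq> b" for t
    using \<delta>_left[of t] \<delta>_right[of t] that t0 less_trans[of a "ereal t0" "ereal t"]
    by (cases "t < b") auto
  have "continuous_on ({t0..b} \<union> {b..b + e}) \<delta>"
  proof (rule continuous_on_closed_Un)
    show "continuous_on {t0..b} \<delta>"
    proof (clarsimp simp: continuous_on_eq_continuous_within)
      fix t assume t: "t0 \<le> t" "t \<le> b"
      show "continuous (at t within {t0..b}) \<delta>"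
      proof (cases "t = b")
        case True
        have "(\<delta> \<longlongrightarrow> \<delta> b) (at_left b)"
        proof -
          have "\<forall>\<^sub>F s in at_left b. \<gamma> s = \<delta> s"
            by (simp add: \<delta>_def eventually_at_filter)
          then have "(\<delta> \<longlongrightarrow> x0) (at_left b)"
            by (rule Lim_transform_eventually[OF lim])
          then show ?thesis
            using u0 by (simp add: \<delta>_def)
        qed
        then show ?thesis
          using True t0 by (simp add: continuous_within at_within_Icc_at_left)
      next
        case False
        then have "a < ereal t" "t < b"
          using t t0 by (auto intro: less_le_trans)
        then show ?thesis
          using \<delta>_left has_vector_derivative_continuous continuous_at_imp_continuous_at_within by blast
      qed
    qed
    have "continuous_on {b..b + e} (\<lambda>t. u (t - b))"
      by (rule continuous_on_compose2[OF u_cont]) (auto intro!: continuous_intros)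
    then show "continuous_on {b..b + e} \<delta>"
      by (rule continuous_on_eq) (auto simp: \<delta>_def)
  qed auto
  moreover have "{t0..b} \<union> {b..b + e} = {t0..b + e}"
    using t0 e by auto
  ultimately have \<delta>_cont: "continuous_on {t0..b + e} \<delta>"
    by simp
  have X\<delta>_cont: "continuous_on {t0..b + e} (\<lambda>t. X (\<delta> t))"
    using t0 by (intro continuous_on_compose2[OF X_cont \<delta>_cont])
      (auto intro!: \<delta>U intro: less_le_trans)
  \<comment> \<open>The fundamental theorem permits the exceptional point \<open>b\<close>, where
    differentiability is not known yet.\<close>
  have \<delta>_int: "\<delta> t0 + integral {t0..t} (\<lambda>s. X (\<delta> s)) = \<delta> t" if t: "t \<in> {t0..b + e}" for t
  proof -
    have "((\<lambda>s. X (\<delta> s)) has_integral \<delta> t - \<delta> t0) {t0..t}"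
      by (rule fundamental_theorem_of_calculus_interior_strong[of "{b}"])
        (use t deriv in \<open>auto intro: continuous_on_subset[OF \<delta>_cont]\<close>)
    then show ?thesis
      by (simp add: integral_unique)
  qed
  have \<delta>_b: "(\<delta> has_vector_derivative X (\<delta> b)) (at b)"
  proof -
    have "((\<lambda>t. integral {t0..t} (\<lambda>s. X (\<delta> s))) has_vector_derivative X (\<delta> b)) (at b within {t0..b + e})"
      using t0 e by (intro integral_has_vector_derivative X\<delta>_cont) auto
    then have "((\<lambda>t. \<delta> t0 + integral {t0..t} (\<lambda>s. X (\<delta> s))) has_vector_derivative X (\<delta> b)) (at b)"
      using t0 e by (auto simp: at_within_Icc_at intro!: derivative_eq_intros)
    then show ?thesis
      by (rule has_vector_derivative_transform_within_open[of _ _ _ "{t0<..<b + e}"])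
        (use t0 e in \<open>auto simp: \<delta>_int\<close>)
  qed
  show thesis
  proof (rule that[of "b + e" \<delta>])
    show "ode_solution U X a (b + e) \<delta>"
      using \<delta>U \<delta>_left \<delta>_right \<delta>_b
      by (auto simp: ode_solution_def ereal_interval_def) (metis linorder_cases)
    show "\<delta> t = \<gamma> t" if "t \<in> ereal_interval a b" for t
      using that by (auto simp: \<delta>_def ereal_interval_def)
  qed (use e in auto)
qed

text \<open>Gronwall's estimate bounds \<open>y\<close>, so increments of \<open>y\<close> are
  dominated by a multiple of those of the integral of \<phi>. That integral is increasing and
  bounded by \<open>M\<close>, hence has small increments near \<open>b\<close>, and
  \<open>y\<close> is Cauchy there.\<close>

lemma gronwall_convergent:
  fixes y :: "real \<Rightarrow> 'a::euclidean_space"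
  assumes y: "\<And>t. t \<in> {0..<b} \<Longrightarrow> (y has_vector_derivative y' t) (at t)"
    and y': "\<And>t. t \<in> {0..<b} \<Longrightarrow> norm (y' t) \<le> \<phi> t * norm (y t)"
    and \<phi>: "continuous_on {0..<b} \<phi>" "\<And>t. t \<in> {0..<b} \<Longrightarrow> \<phi> t \<ge> 0"
    and M: "\<And>t. t \<in> {0..<b} \<Longrightarrow> integral {0..t} \<phi> \<le> M" and b: "b > 0"
  obtains l where "(y \<longlongrightarrow> l) (at_left b)"
proof -
  define \<Phi> where "\<Phi> t = integral {0..t} \<phi>" for t
  have \<phi>_int: "\<phi> integrable_on {s..t}" if "0 \<le> s" "t < b" for s t
    using that by (intro integrable_continuous_real continuous_on_subset[OF \<phi>(1)]) auto
  have \<Phi>_diff: "integral {s..t} \<phi> = \<Phi> t - \<Phi> s" if "0 \<le> s" "s \<le> t" "t < b" for s t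
    using Henstock_Kurzweil_Integration.integral_combine[OF that(1,2) \<phi>_int] that by (simp add: \<Phi>_def)
  have \<Phi>_mono: "\<Phi> s \<le> \<Phi> t" if "0 \<le> s" "s \<le> t" "t < b" for s t
    using \<Phi>_diff[OF that] integral_nonneg[OF \<phi>_int[of s t]] \<phi>(2) that by fastforce
  have \<Phi>_deriv: "(\<Phi> has_real_derivative \<phi> t) (at t within {0..c})" if "t \<in> {0..c}" "c < b" for t c
    unfolding \<Phi>_def has_real_derivative_iff_has_vector_derivative
    using that by (intro integral_has_vector_derivative continuous_on_subset[OF \<phi>(1)]) auto
  have y_cont: "continuous_on {s..t} y" if "0 \<le> s" "t < b" for s t
    using that by (intro continuous_at_imp_continuous_on ballI has_vector_derivative_continuous[OF y]) auto
  define R where "R = norm (y 0) * exp M"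
  have R: "norm (y t) \<le> R" if t: "t \<in> {0..<b}" for t
  proof -
    \<comment> \<open>Growth of \<open>y\<close> at rate at most \<phi> makes \<open>z\<close>
      nonincreasing. The squared norm is differentiable also where \<open>y\<close>
      vanishes.\<close>
    define z where "z s = (y s \<bullet> y s) * exp (- 2 * \<Phi> s)" for s
    have "z t \<le> z 0"
    proof (cases "t = 0")
      case False
      show ?thesis
      proof (rule DERIV_nonpos_imp_decreasing_open[of 0 t z])
        have "continuous_on {0..t} \<Phi>"
          using \<Phi>_deriv t by (intro DERIV_continuous_on) auto
        then show "continuous_on {0..t} z"
          using y_cont[of 0 t] t unfolding z_def by (intro continuous_intros) auto
        fix s assume s: "0 < s" "s < t"
        then have s': "s \<in> {0..<b}"
          using t by auto
        have \<Phi>s: "(\<Phi> has_real_derivative \<phi> s) (at s)"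
          using \<Phi>_deriv[of s t] s t by (simp add: at_within_Icc_at)
        have "((\<lambda>s. y s \<bullet> y s) has_real_derivative (y s \<bullet> y' s + y' s \<bullet> y s)) (at s)"
          unfolding has_real_derivative_iff_has_vector_derivative
          using bounded_bilinear.has_vector_derivative[OF bounded_bilinear_inner y[OF s'] y[OF s']] .
        then have zd: "(z has_real_derivative (2 * (y s \<bullet> y' s) - 2 * \<phi> s * (y s \<bullet> y s)) * exp (- 2 * \<Phi> s)) (at s)"
          unfolding z_def
          by (auto intro!: derivative_eq_intros \<Phi>s simp: inner_commute algebra_simps)
        have "y s \<bullet> y' s \<le> norm (y s) * norm (y' s)"
          by (rule norm_cauchy_schwarz)
        also have "\<dots> \<le> norm (y s) * (\<phi> s * norm (y s))"
          using y'[OF s'] by (intro mult_left_mono) auto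
        also have "\<dots> = \<phi> s * (y s \<bullet> y s)"
          by (simp add: power2_norm_eq_inner[symmetric] power2_eq_square)
        finally have "(2 * (y s \<bullet> y' s) - 2 * \<phi> s * (y s \<bullet> y s)) * exp (- 2 * \<Phi> s) \<le> 0"
          by (intro mult_nonpos_nonneg) auto
        with zd show "\<exists>d. DERIV z s :> d \<and> d \<le> 0"
          by blast
      qed (use t False in auto)
    qed simp
    then have "(norm (y t))\<^sup>2 \<le> (norm (y 0))\<^sup>2 * exp (2 * \<Phi> t)"
      by (simp add: z_def \<Phi>_def power2_norm_eq_inner exp_minus field_simps)
    also have "\<dots> \<le> (norm (y 0))\<^sup>2 * exp (2 * M)"
      using M[OF t] by (intro mult_left_mono) (auto simp: \<Phi>_def)
    also have "\<dots> = R\<^sup>2"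
      by (simp add: R_def power_mult_distrib exp_double)
    finally show ?thesis
      by (rule power2_le_imp_le) (simp add: R_def)
  qed
  have y_diff: "dist (y s) (y t) \<le> R * (\<Phi> t - \<Phi> s)" if st: "0 \<le> s" "s \<le> t" "t < b" for s t
  proof -
    \<comment> \<open>The fundamental theorem also supplies the integrability of \<open>y'\<close>,
      which is not assumed continuous.\<close>
    have int: "(y' has_integral y t - y s) {s..t}"
    proof (rule fundamental_theorem_of_calculus)
      show "(y has_vector_derivative y' r) (at r within {s..t})" if "r \<in> {s..t}" for r
        by (rule has_vector_derivative_at_within[OF y]) (use that st in auto)
    qed (use st in simp)
    have "norm (integral {s..t} y') \<le> integral {s..t} (\<lambda>r. R * \<phi> r)"
    proof (rule integral_norm_bound_integral)
      show "y' integrable_on {s..t}"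
        using int by blast
      show "(\<lambda>r. R * \<phi> r) integrable_on {s..t}"
        using \<phi>_int st integrable_cmul[of \<phi> "{s..t}" R] by simp
      fix r assume r: "r \<in> {s..t}"
      then have r': "r \<in> {0..<b}"
        using st by auto
      show "norm (y' r) \<le> R * \<phi> r"
        using y'[OF r'] mult_left_mono[OF R[OF r'] \<phi>(2)[OF r']] by (simp add: mult.commute)
    qed
    then show ?thesis
      using int st by (simp add: integral_unique dist_norm norm_minus_commute[of "y t"] \<Phi>_diff)
  qed
  have R0: "R \<ge> 0"
    by (simp add: R_def)
  have bdd: "bdd_above (\<Phi> ` {0..<b})"
    using M by (intro bdd_aboveI2[of _ _ M]) (simp add: \<Phi>_def)
  define \<Lambda> where "\<Lambda> = (SUP t\<in>{0..<b}. \<Phi> t)"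
  have \<Lambda>: "\<Phi> t \<le> \<Lambda>" if "t \<in> {0..<b}" for t
    unfolding \<Lambda>_def using bdd that by (intro cSUP_upper) auto
  have "cauchy_filter (filtermap y (at_left b))"
    unfolding cauchy_filter_metric_filtermap
  proof (intro allI impI)
    fix \<epsilon> :: real assume "\<epsilon> > 0"
    \<comment> \<open>Past a time where \<Phi> is this close to its supremum, increments of
      \<open>y\<close> are below \<epsilon>; dividing by \<open>R + 1\<close> covers the case
      \<open>R = 0\<close>.\<close>
    then have "\<Lambda> - \<epsilon> / (R + 1) < \<Lambda>"
      using R0 by simp
    moreover have "{0..<b} \<noteq> {}"
      using b by auto
    ultimately obtain t1 where t1: "t1 \<in> {0..<b}" "\<Lambda> - \<epsilon> / (R + 1) < \<Phi> t1"
      using less_cSUP_iff[OF _ bdd] unfolding \<Lambda>_def by blast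
    have close: "dist (y s) (y t) < \<epsilon>" if "t1 < s" "s \<le> t" "t < b" for s t
    proof -
      have "\<Phi> t1 \<le> \<Phi> s" "\<Phi> t \<le> \<Lambda>"
        using that t1 by (auto intro!: \<Phi>_mono \<Lambda>)
      then have *: "\<Phi> t - \<Phi> s \<le> \<epsilon> / (R + 1)"
        using t1 by linarith
      have "dist (y s) (y t) \<le> R * (\<epsilon> / (R + 1))"
        using y_diff[of s t] mult_left_mono[OF * R0] that t1 by simp
      also have "\<dots> < \<epsilon>"
        using R0 \<open>\<epsilon> > 0\<close> by (simp add: field_simps)
      finally show ?thesis .
    qed
    show "\<exists>P. eventually P (at_left b) \<and> (\<forall>s t. P s \<and> P t \<longrightarrow> dist (y s) (y t) < \<epsilon>)"
    proof (intro exI conjI allI impI)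
      show "eventually (\<lambda>t. t \<in> {t1<..<b}) (at_left b)"
        using t1 by (intro eventually_at_leftI) auto
      show "dist (y s) (y t) < \<epsilon>" if "s \<in> {t1<..<b} \<and> t \<in> {t1<..<b}" for s t
        using close[of s t] close[of t s] that by (cases "s \<le> t") (auto simp: dist_commute)
    qed
  qed
  then obtain l where "filtermap y (at_left b) \<le> nhds l"
    using cauchy_filter_complete_converges[OF _ complete_UNIV, of "filtermap y (at_left b)"]
    by (auto simp: filtermap_bot_iff)
  then show thesis
    using that by (simp add: filterlim_def)
qed

text \<open>Passes from the extended Lebesgue integral in the claim to the integral in Gronwall's
  estimate. Only the open interval has to lie in \<open>A\<close>, since 0 is excluded from both
  half-intervals. Finiteness matters because \<open>enn2real\<close> sends infinity to 0.\<close>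

lemma integral_le_set_nn_integral:
  fixes \<phi> :: "real \<Rightarrow> real"
  assumes \<phi>: "continuous_on {c..d} \<phi>" "\<And>t. t \<in> {c..d} \<Longrightarrow> \<phi> t \<ge> 0"
    and A: "{c<..<d} \<subseteq> A" and fin: "(\<integral>\<^sup>+ t\<in>A. ennreal (\<phi> t) \<partial>lborel) \<noteq> \<infinity>"
  shows "integral {c..d} \<phi> \<le> enn2real (\<integral>\<^sup>+ t\<in>A. ennreal (\<phi> t) \<partial>lborel)"
proof -
  have "(\<phi> has_integral integral {c..d} \<phi>) {c<..<d}"
    using \<phi>(1) by (simp add: has_integral_Icc_iff_Ioo[symmetric] integrable_continuous_real integrable_integral)
  then have "ennreal (integral {c..d} \<phi>) = (\<integral>\<^sup>+ t. ennreal (indicator {c<..<d} t * \<phi> t) \<partial>lborel)"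
    using \<phi>(2) by (subst nn_integral_has_integral_lebesgue) auto
  also have "\<dots> \<le> (\<integral>\<^sup>+ t\<in>A. ennreal (\<phi> t) \<partial>lborel)"
    using A by (intro nn_integral_mono) (auto simp: indicator_def)
  finally show ?thesis
    using fin by (metis enn2real_ennreal enn2real_mono integral_nonneg integrable_continuous_real
        \<phi> infinity_ennreal_def top.not_eq_extremum)
qed

section \<open>Extending a gauged solution\<close>

lemma tendsto_tact:
  fixes h :: "'a \<Rightarrow> real^'n^'n"
  assumes h: "(h \<longlongrightarrow> h0) F" "invertible h0" and x: "(x \<longlongrightarrow> x0) F"
  shows "((\<lambda>s. tact var (h s) (x s)) \<longlongrightarrow> tact var h0 x0) F"
proof -
  have "((\<lambda>s. slot_coeff v (h s) i j) \<longlongrightarrow> slot_coeff v h0 i j) F" for v i j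
    using tendsto_matrix_inv[OF h] h(1)
    by (cases v) (auto simp: slot_coeff_def intro!: tendsto_vec_nth)
  then show ?thesis
    unfolding tact_def by (intro tendsto_vec_lambda tendsto_sum tendsto_mult tendsto_prod tendsto_vec_nth x)
qed

text \<open>Serves time reversal, which replaces the operator \<open>Q\<close> by its
  negative.\<close>

lemma transported_complement_uminus:
  assumes "subspace \<qq>" "A \<in> transported_complement var x \<qq> y"
  shows "- A \<in> transported_complement var x \<qq> y"
proof -
  obtain g B where "invertible g" "y = tact var g x" "B \<in> \<qq>" "A = g ** B ** matrix_inv g"
    using assms(2) by (auto simp: transported_complement_def)
  moreover from this have "- A = g ** (- B) ** matrix_inv g"
    by (simp add: matrix_mult_minus_left matrix_mult_minus_right)
  ultimately show ?thesis
    using assms(1) subspace_neg unfolding transported_complement_def by blast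
qed

text \<open>The transported curve has derivative 0: in the product rule the motion of the gauge
  contributes -\<theta>(Q) and the motion of \<gamma> contributes \<theta>(Q).\<close>

lemma gauged_solution_eq:
  fixes h Q :: "real \<Rightarrow> real^'n^'n"
  assumes I: "open I" "convex I" "0 \<in> I"
    and \<gamma>: "\<And>t. t \<in> I \<Longrightarrow> (\<gamma> has_vector_derivative inf_act var (Q t) (\<gamma> t)) (at t)"
    and h0: "h 0 = mat 1" and inv: "\<And>t. t \<in> I \<Longrightarrow> invertible (h t)"
    and h: "\<And>t. t \<in> I \<Longrightarrow> (h has_vector_derivative - (h t ** Q t)) (at t)"
    and t: "t \<in> I"
  shows "tact var (h t) (\<gamma> t) = \<gamma> 0"
proof -
  have "((\<lambda>s. tact var (h s) (\<gamma> s)) has_vector_derivative 0) (at r)" if r: "r \<in> I" for r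
  proof -
    \<comment> \<open>Normalizing the gauge at time \<open>r\<close> makes it the identity there, as
      the product rule requires; the fixed factor \<open>h r\<close> is put back afterwards.\<close>
    let ?g = "\<lambda>s. matrix_inv (h r) ** h s"
    have "(?g has_vector_derivative matrix_inv (h r) ** - (h r ** Q r)) (at r)"
      by (rule bounded_linear.has_vector_derivative
          [OF bounded_bilinear.bounded_linear_right[OF bounded_bilinear_matrix_mult] h[OF r]])
    moreover have "matrix_inv (h r) ** - (h r ** Q r) = - Q r"
      using inv[OF r] by (simp add: matrix_mult_minus_right matrix_mul_assoc)
    ultimately have "((\<lambda>s. tact var (?g s) (\<gamma> s)) has_vector_derivative
        lin_act var (- Q r) (\<gamma> r) + lin_act var (Q r) (\<gamma> r)) (at r)"
      using \<gamma>[OF r] inv[OF r] by (intro has_vector_derivative_tact) (simp_all add: inf_act_eq_lin_act)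
    then have "((\<lambda>s. tact var (?g s) (\<gamma> s)) has_vector_derivative 0) (at r)"
      by (simp add: linear_neg[OF linear_lin_act])
    then have "((\<lambda>s. tact var (h r) (tact var (?g s) (\<gamma> s))) has_vector_derivative tact var (h r) 0) (at r)"
      by (rule bounded_linear.has_vector_derivative[OF bounded_linear_tact])
    then have "((\<lambda>s. tact var (h r) (tact var (?g s) (\<gamma> s))) has_vector_derivative 0) (at r)"
      by (simp add: linear_0[OF linear_tact])
    then show ?thesis
      by (rule has_vector_derivative_transform_within_open[OF _ I(1) r])
        (use inv r in \<open>simp add: matrix_mul_assoc invertible_mult flip: tact_mult\<close>)
  qed
  then have "((\<lambda>s. tact var (h s) (\<gamma> s)) has_derivative (\<lambda>_. 0)) (at r within I)" if "r \<in> I" for r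
    using that by (simp add: has_vector_derivative_def has_derivative_at_withinI)
  from has_derivative_zero_unique[OF I(2) this t I(3)] show ?thesis
    by (simp add: h0)
qed

text \<open>The velocity transported back to the fixed structure \<open>x\<close> lies in the fixed complement, on which
  \<open>A \<mapsto> inf_act var A x\<close> is injective; this is what bounds \<open>h Q h\<^sup>-\<^sup>1\<close> by the norm of the velocity.\<close>

lemma gauge_velocity_bound:
  fixes P :: "real^'n^'n"
  assumes compl: "invariant_complement var x \<qq>" and P: "invertible P"
  obtains c where "c > 0"
    "\<And>h y Q. invertible h \<Longrightarrow> tact var h y = x \<Longrightarrow> Q \<in> transported_complement var x \<qq> y \<Longrightarrow>
       norm (h ** Q ** matrix_inv h) \<le> c * norm (tact var (P ** h) (inf_act var Q y))"
proof -
  have \<qq>: "subspace \<qq>" and inj: "\<And>A. A \<in> \<qq> \<Longrightarrow> lin_act var A x = 0 \<Longrightarrow> A = 0"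
    and stab: "\<And>g A. g \<in> stabilizer var x \<Longrightarrow> A \<in> \<qq> \<Longrightarrow> g ** A ** matrix_inv g \<in> \<qq>"
    using compl by (auto simp: invariant_complement_def inf_stabilizer_def inf_act_eq_lin_act)
  have "linear (\<lambda>A. tact var P (lin_act var A x))"
    using linear_compose[OF linear_lin_act linear_tact] by (simp add: o_def)
  then have "bounded_linear (\<lambda>A. tact var P (lin_act var A x))"
    by (simp only: linear_conv_bounded_linear)
  moreover have "\<forall>A\<in>\<qq>. tact var P (lin_act var A x) = 0 \<longrightarrow> A = 0"
  proof (intro ballI impI)
    fix A assume "A \<in> \<qq>" "tact var P (lin_act var A x) = 0"
    then show "A = 0"
      using inj tact_matrix_inv(1)[OF P, of var "lin_act var A x"]
      by (simp add: linear_0[OF linear_tact])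
  qed
  \<comment> \<open>In finite dimension a linear map that is injective on a subspace is bounded
    below there.\<close>
  ultimately obtain e where "e > 0 \<and> (\<forall>A\<in>\<qq>. norm (tact var P (lin_act var A x)) \<ge> e * norm A)"
    using injective_imp_isometric[OF closed_subspace[OF \<qq>] \<qq>] by blast
  then have e: "e > 0" "\<And>A. A \<in> \<qq> \<Longrightarrow> norm (tact var P (lin_act var A x)) \<ge> e * norm A"
    by simp_all
  have "norm (h ** Q ** matrix_inv h) \<le> (1 / e) * norm (tact var (P ** h) (inf_act var Q y))"
    if h: "invertible h" "tact var h y = x" and Q: "Q \<in> transported_complement var x \<qq> y" for h y Q
  proof -
    obtain g A where g: "invertible g" "y = tact var g x" "A \<in> \<qq>" "Q = g ** A ** matrix_inv g"
      using Q by (auto simp: transported_complement_def)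
    \<comment> \<open>\<open>g\<close> carries \<open>x\<close> to \<open>y\<close> and
      \<open>h\<close> carries \<open>y\<close> back, so \<open>h ** g\<close> fixes
      \<open>x\<close>, and invariance of the complement applies to the conjugated operator.\<close>
    have "h ** g \<in> stabilizer var x"
      using h g by (simp add: stabilizer_def invertible_mult tact_mult)
    then have "(h ** g) ** A ** matrix_inv (h ** g) \<in> \<qq>"
      by (rule stab[OF _ g(3)])
    moreover have "(h ** g) ** A ** matrix_inv (h ** g) = h ** Q ** matrix_inv h"
      using h(1) g(1) by (simp add: g(4) matrix_inv_mult matrix_mul_assoc)
    ultimately have "e * norm (h ** Q ** matrix_inv h) \<le>
        norm (tact var P (lin_act var (h ** Q ** matrix_inv h) x))"
      using e by auto
    also have "lin_act var (h ** Q ** matrix_inv h) x = tact var h (inf_act var Q y)"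
      using h by (simp add: inf_act_eq_lin_act tact_lin_act)
    finally show ?thesis
      using e h P by (simp add: tact_mult field_simps)
  qed
  then show thesis
    using that[of "1 / e"] e(1) by simp
qed

lemma open_convex_ereal_interval: "open (ereal_interval a b)" "convex (ereal_interval a b)"
proof -
  have "ereal_interval a b = ereal -` {a<..<b}"
    by (auto simp: ereal_interval_def)
  then show "open (ereal_interval a b)"
    by (simp add: open_vimage continuous_on_ereal)
  show "convex (ereal_interval a b)"
  proof (rule is_interval_convex, unfold is_interval_1, intro ballI allI impI)
    fix s t r assume "s \<in> ereal_interval a b" "t \<in> ereal_interval a b" "s \<le> r \<and> r \<le> t"
    then show "r \<in> ereal_interval a b"
      using less_le_trans[of a "ereal s" "ereal r"] le_less_trans[of "ereal r" "ereal t" b]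
      by (simp add: ereal_interval_def)
  qed
qed

text \<open>Stated for a general field \<open>X\<close>, so that it serves the flow and its time
  reversal alike. The bound \<open>M\<close> controls the growth of the gauge and of its inverse;
  both converge at \<open>b\<close>, and so does \<gamma>.\<close>

lemma solution_extends_forward:
  fixes h Q :: "real \<Rightarrow> real^'n^'n" and b :: real and P :: "real^'n^'n"
    and \<gamma> :: "real \<Rightarrow> ('k::finite, 's::finite, 'n::finite) tensor"
  assumes W: "subspace W" and U: "openin (top_of_set W) (W \<inter> S)"
    and S: "\<And>g. invertible g \<Longrightarrow> tact var g (\<gamma> 0) \<in> S"
    and X: "\<And>x. x \<in> W \<inter> S \<Longrightarrow> X x \<in> W" "local_lipschitz (UNIV :: real set) (W \<inter> S) (\<lambda>_. X)"
    and ab: "a < 0" "0 < b"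
    and sol: "ode_solution (W \<inter> S) X a b \<gamma>"
    and complement: "invariant_complement var (\<gamma> 0) \<qq>"
    and velocity: "\<And>t. t \<in> ereal_interval a b \<Longrightarrow>
         Q t \<in> transported_complement var (\<gamma> 0) \<qq> (\<gamma> t) \<and> X (\<gamma> t) = inf_act var (Q t) (\<gamma> t)"
    and gauge: "h 0 = mat 1" "\<And>t. t \<in> ereal_interval a b \<Longrightarrow>
         invertible (h t) \<and> (h has_vector_derivative - (h t ** Q t)) (at t)"
    and P: "invertible P"
    and cont: "continuous_on (ereal_interval a b) (\<lambda>t. norm (tact var (P ** h t) (X (\<gamma> t))))"
    and M: "\<And>t. t \<in> {0..<b} \<Longrightarrow> integral {0..t} (\<lambda>t. norm (tact var (P ** h t) (X (\<gamma> t)))) \<le> M"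
  shows "\<exists>b'>b. \<exists>\<delta>. ode_solution (W \<inter> S) X a (ereal b') \<delta> \<and> (\<forall>t\<in>ereal_interval a b. \<delta> t = \<gamma> t)"
proof -
  let ?I = "ereal_interval a b"
  define \<phi> where "\<phi> t = norm (tact var (P ** h t) (X (\<gamma> t)))" for t
  define k where "k t = matrix_inv (h t)" for t
  \<comment> \<open>Conjugation turns the gauge equation into h' = -A h and gives k' = k A for the
    inverse, so one bound on |A| controls both.\<close>
  define A where "A t = h t ** Q t ** k t" for t
  have I: "t \<in> ?I" if "t \<in> {0..<b}" for t
    using that ab by (auto simp: ereal_interval_def intro: less_le_trans)
  have inv: "invertible (h t)" and h: "(h has_vector_derivative - (h t ** Q t)) (at t)" if "t \<in> ?I" for t
    using gauge(2)[OF that] by auto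
  have h\<gamma>: "tact var (h t) (\<gamma> t) = \<gamma> 0" if "t \<in> ?I" for t
  proof (rule gauged_solution_eq[OF open_convex_ereal_interval _ _ gauge(1) inv h that])
    show "0 \<in> ?I"
      using I[of 0] ab by simp
    show "(\<gamma> has_vector_derivative inf_act var (Q t) (\<gamma> t)) (at t)" if "t \<in> ?I" for t
      using sol velocity[OF that] that unfolding ode_solution_def by metis
  qed
  obtain c where c: "c > 0" "\<And>h y Q. invertible h \<Longrightarrow> tact var h y = \<gamma> 0 \<Longrightarrow>
      Q \<in> transported_complement var (\<gamma> 0) \<qq> y \<Longrightarrow>
      norm (h ** Q ** matrix_inv h) \<le> c * norm (tact var (P ** h) (inf_act var Q y))"
    using gauge_velocity_bound[OF complement P] by metis
  have A: "norm (A t) \<le> c * \<phi> t" if "t \<in> ?I" for t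
    using c(2)[OF inv h\<gamma>, of t "Q t"] velocity[OF that] that by (simp add: A_def k_def \<phi>_def)
  obtain C where C: "C > 0" and norm_mult: "\<forall>(A :: real^'n^'n) B :: real^'n^'n. norm (A ** B) \<le> norm A * norm B * C"
    using bounded_bilinear.pos_bounded[OF bounded_bilinear_matrix_mult] by (elim exE conjE) (rule that)
  define \<psi> where "\<psi> t = (C * c) * \<phi> t" for t
  have \<phi>_cont: "continuous_on {0..<b} \<phi>"
    unfolding \<phi>_def by (rule continuous_on_subset[OF cont]) (use I in auto)
  have \<psi>: "continuous_on {0..<b} \<psi>" "\<And>t. t \<in> {0..<b} \<Longrightarrow> \<psi> t \<ge> 0"
    "\<And>t. t \<in> {0..<b} \<Longrightarrow> integral {0..t} \<psi> \<le> (C * c) * M"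
  proof -
    show "continuous_on {0..<b} \<psi>"
      unfolding \<psi>_def by (intro continuous_intros \<phi>_cont)
    show "\<psi> t \<ge> 0" for t
      using C c(1) by (simp add: \<psi>_def \<phi>_def)
    show "integral {0..t} \<psi> \<le> (C * c) * M" if "t \<in> {0..<b}" for t
      using mult_left_mono[OF M[OF that], of "C * c"] C c(1) by (simp add: \<psi>_def[abs_def] \<phi>_def[abs_def])
  qed
  have mult_A: "norm (A t ** B) \<le> \<psi> t * norm B" "norm (B ** A t) \<le> \<psi> t * norm B" if "t \<in> ?I" for t B
  proof -
    have "norm (A t) * (C * norm B) \<le> (c * \<phi> t) * (C * norm B)"
      using A[OF that] C by (intro mult_right_mono) auto
    then show "norm (A t ** B) \<le> \<psi> t * norm B" "norm (B ** A t) \<le> \<psi> t * norm B"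
      using norm_mult[rule_format, of "A t" B] norm_mult[rule_format, of B "A t"]
      by (simp_all add: \<psi>_def mult_ac)
  qed
  obtain h1 where h1: "(h \<longlongrightarrow> h1) (at_left b)"
  proof (rule gronwall_convergent[of b h "\<lambda>t. - (h t ** Q t)" \<psi>])
    fix t assume "t \<in> {0..<b}"
    then have t: "t \<in> ?I"
      by (rule I)
    show "(h has_vector_derivative - (h t ** Q t)) (at t)"
      using t by (rule h)
    have "h t ** Q t = A t ** h t"
      using inv[OF t] by (simp add: A_def k_def flip: matrix_mul_assoc)
    then show "norm (- (h t ** Q t)) \<le> \<psi> t * norm (h t)"
      using mult_A(1)[OF t, of "h t"] by simp
  qed (use \<psi> ab in auto)
  \<comment> \<open>Convergence of \<open>h\<close> alone would allow a singular limit; convergence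
    of the inverses excludes this by passing to the limit in h k = 1.\<close>
  obtain k1 where k1: "(k \<longlongrightarrow> k1) (at_left b)"
  proof (rule gronwall_convergent[of b k "\<lambda>t. k t ** A t" \<psi>])
    fix t assume "t \<in> {0..<b}"
    then have t: "t \<in> ?I"
      by (rule I)
    have "- (k t ** - (h t ** Q t) ** k t) = k t ** A t"
      by (simp add: A_def matrix_mult_minus_left matrix_mult_minus_right matrix_mul_assoc)
    then show "(k has_vector_derivative k t ** A t) (at t)"
      using has_vector_derivative_matrix_inv[OF h[OF t] inv[OF t]] by (simp add: k_def[abs_def])
    show "norm (k t ** A t) \<le> \<psi> t * norm (k t)"
      using mult_A(2)[OF t, of "k t"] .
  qed (use \<psi> ab in auto)
  have ev: "\<forall>\<^sub>F t in at_left b. t \<in> ?I"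
    using ab I by (intro eventually_at_leftI[of 0]) auto
  have "((\<lambda>t. h t ** k t) \<longlongrightarrow> h1 ** k1) (at_left b)"
    by (rule tendsto_matrix_mult[OF h1 k1])
  moreover have "\<forall>\<^sub>F t in at_left b. h t ** k t = mat 1"
    using ev by eventually_elim (simp add: k_def inv)
  ultimately have "((\<lambda>_. mat 1) \<longlongrightarrow> h1 ** k1) (at_left b)"
    by (rule Lim_transform_eventually)
  then have "h1 ** k1 = mat 1"
    using tendsto_unique[OF trivial_limit_at_left_real _ tendsto_const] by metis
  then have k1_inv: "invertible k1"
    using invertible_left_inverse by blast
  have \<gamma>_eq: "\<forall>\<^sub>F t in at_left b. tact var (k t) (\<gamma> 0) = \<gamma> t"
    using ev
  proof eventually_elim
    case (elim t)
    then show ?case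
      using tact_matrix_inv(1)[OF inv[OF elim], of var "\<gamma> t"] by (simp add: h\<gamma> k_def)
  qed
  have \<gamma>_lim: "(\<gamma> \<longlongrightarrow> tact var k1 (\<gamma> 0)) (at_left b)"
    using tendsto_tact[OF k1 k1_inv tendsto_const] \<gamma>_eq by (rule Lim_transform_eventually)
  \<comment> \<open>The limit stays in \<open>W\<close> because \<open>W\<close> is closed.
    \<open>S\<close> need not be closed; membership there comes from the limit lying in the orbit of
    \<open>\<gamma> 0\<close>.\<close>
  have "tact var k1 (\<gamma> 0) \<in> W"
  proof (rule Lim_in_closed_set[OF closed_subspace[OF W] _ _ \<gamma>_lim])
    show "\<forall>\<^sub>F t in at_left b. \<gamma> t \<in> W"
      using ev by eventually_elim (use sol in \<open>auto simp: ode_solution_def\<close>)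
  qed simp
  then have lim_mem: "tact var k1 (\<gamma> 0) \<in> W \<inter> S"
    using S[OF k1_inv] by blast
  have "a < ereal b"
    using ab by (metis ereal_less(2) less_trans)
  from ode_solution_extends[OF W U X sol this \<gamma>_lim lim_mem] show ?thesis
    by metis
qed

section \<open>Time reversal and maximality\<close>

lemma uminus_mem_ereal_interval: "- t \<in> ereal_interval a b \<longleftrightarrow> t \<in> ereal_interval (- b) (- a)"
  by (cases a; cases b) (auto simp: ereal_interval_def)

lemma has_vector_derivative_reflect:
  assumes "(f has_vector_derivative D) (at (- t))"
  shows "((\<lambda>s. f (- s)) has_vector_derivative - D) (at t)"
proof -
  have "(uminus has_vector_derivative - 1) (at t)"
    by (auto intro!: derivative_eq_intros)
  then show ?thesis
    using vector_diff_chain_at[of uminus "- 1" t f D] assms by (simp add: o_def)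
qed

lemma ode_solution_reflect:
  assumes "ode_solution U X a b \<gamma>"
  shows "ode_solution U (\<lambda>x. - X x) (- b) (- a) (\<lambda>t. \<gamma> (- t))"
  using assms unfolding ode_solution_def
  by (metis has_vector_derivative_reflect uminus_mem_ereal_interval)

lemma maximal_ode_solution_no_extension:
  assumes "maximal_ode_solution U X a b \<gamma>"
  shows "\<lbrakk>b < b'; ode_solution U X a b' \<delta>; \<forall>t\<in>ereal_interval a b. \<delta> t = \<gamma> t\<rbrakk> \<Longrightarrow> False"
    and "\<lbrakk>a' < a; ode_solution U X a' b \<delta>; \<forall>t\<in>ereal_interval a b. \<delta> t = \<gamma> t\<rbrakk> \<Longrightarrow> False"
  using assms unfolding maximal_ode_solution_def by (metis less_imp_le order_refl less_irrefl)+

lemma subspace_Ad_invariants: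
  assumes "subspace T"
  shows "subspace (Ad_invariants var T G c0 K F)"
  using assms unfolding subspace_def Ad_invariants_def
  by (auto simp: linear_add[OF linear_tact] linear_scale[OF linear_tact] linear_0[OF linear_tact])

theorem proposition4p7:
  fixes var :: "'k::finite \<Rightarrow> 's::finite \<Rightarrow> variance"
    and T S :: "('k, 's, 'n::finite) tensor set"
    and q :: "('g set, real^'n) mfd \<Rightarrow> ('g set, 'k, 's, 'n) field \<Rightarrow> ('g set, 'k, 's, 'n) field"
    and G :: "'g monoid"
    and MG :: "('g, 'e::euclidean_space) mfd"
    and K :: "'g set"
    and M :: "('g set, real^'n) mfd"
    and c0 :: "('g, 'e) chart"
    and \<pp> :: "'e set"
    and F :: "real^'n \<Rightarrow> 'e"
    and ip :: "real^'n \<Rightarrow> real^'n \<Rightarrow> real"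
    and \<qq> :: "(real^'n^'n) set"
    and Tm Tp :: ereal
    and \<gamma> :: "real \<Rightarrow> ('k, 's, 'n) tensor"
    and Q h :: "real \<Rightarrow> real^'n^'n"
  assumes structures: "structure_type var T S"
    and flow: "diffeo_invariant_flow var T S q"
    and homogeneous: "homogeneous_space G MG K M"
    and identity_chart: "c0 \<in> atlas MG" "\<one>\<^bsub>G\<^esub> \<in> fst c0"
    and reductive: "reductive_complement G MG c0 K \<pp>"
    and basis: "basis_iso \<pp> F"
    and smooth_rhs:
      "smooth_vector_field (Ad_invariants var T G c0 K F) (Ad_invariants var T G c0 K F \<inter> S)
         (hom_rhs var q G c0 K M F)"
    and interval: "Tm < 0" "0 < Tp"
    and solution:
      "maximal_ode_solution (Ad_invariants var T G c0 K F \<inter> S) (hom_rhs var q G c0 K M F) Tm Tp \<gamma>"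
    and complement: "invariant_complement var (\<gamma> 0) \<qq>"
    and velocity:
      "\<And>t. t \<in> ereal_interval Tm Tp \<Longrightarrow>
         Q t \<in> transported_complement var (\<gamma> 0) \<qq> (\<gamma> t) \<and>
         hom_rhs var q G c0 K M F (\<gamma> t) = inf_act var (Q t) (\<gamma> t)"
    and gauge:
      "h 0 = mat 1"
      "\<And>t. t \<in> ereal_interval Tm Tp \<Longrightarrow>
         invertible (h t) \<and> (h has_vector_derivative - (h t ** Q t)) (at t)"
    and inner: "inner_product ip"
  shows "(Tp < \<infinity> \<longrightarrow>
            (\<integral>\<^sup>+ t\<in>ereal_interval 0 Tp.
               ennreal (tensor_norm var (\<lambda>v w. ip (h t *v v) (h t *v w))
                          (hom_rhs var q G c0 K M F (\<gamma> t))) \<partial>lborel) = \<infinity>) \<and>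
         (Tm > - \<infinity> \<longrightarrow>
            (\<integral>\<^sup>+ t\<in>ereal_interval Tm 0.
               ennreal (tensor_norm var (\<lambda>v w. ip (h t *v v) (h t *v w))
                          (hom_rhs var q G c0 K M F (\<gamma> t))) \<partial>lborel) = \<infinity>)"
proof -
  define W where "W = Ad_invariants var T G c0 K F"
  define X where "X = hom_rhs var q G c0 K M F"
  let ?I = "ereal_interval Tm Tp"

  \<comment> \<open>Invariant tensors, the initial orbit and the field\<close>
  have W: "subspace W"
    using structures by (simp add: W_def structure_type_def subspace_Ad_invariants)
  have U: "openin (top_of_set W) (W \<inter> S)"
  proof -
    obtain V where "open V" "S = T \<inter> V"
      using structures by (auto simp: structure_type_def openin_open)
    moreover have "W \<subseteq> T"
      by (auto simp: W_def Ad_invariants_def)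
    ultimately show ?thesis
      by (auto simp: openin_open)
  qed
  have max: "maximal_ode_solution (W \<inter> S) X Tm Tp \<gamma>"
    using solution by (simp only: W_def X_def)
  then have sol: "ode_solution (W \<inter> S) X Tm Tp \<gamma>"
    by (simp add: maximal_ode_solution_def)
  have zero: "0 \<in> ?I"
    using interval by (simp add: ereal_interval_def zero_ereal_def)
  \<comment> \<open>\<open>S\<close> is a single orbit, so it contains the whole orbit of each of
    its elements.\<close>
  have orbit: "tact var g (\<gamma> 0) \<in> S" if "invertible g" for g
  proof -
    obtain x where S: "S = {tact var h x | h. invertible h}"
      using structures by (auto simp: structure_type_def)
    have "\<gamma> 0 \<in> S"
      using sol zero by (auto simp: ode_solution_def)
    then obtain k where "invertible k" "\<gamma> 0 = tact var k x"
      by (auto simp: S)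
    then have "tact var g (\<gamma> 0) = tact var (g ** k) x" "invertible (g ** k)"
      using that by (simp_all add: tact_mult invertible_mult)
    then show ?thesis
      by (auto simp: S)
  qed
  have X: "\<And>x. x \<in> W \<inter> S \<Longrightarrow> X x \<in> W" "local_lipschitz (UNIV :: real set) (W \<inter> S) (\<lambda>_. X)"
    using smooth_rhs smooth_vector_field_local_lipschitz[OF smooth_rhs]
    unfolding smooth_vector_field_def W_def X_def by auto
  have neg_X: "\<And>x. x \<in> W \<inter> S \<Longrightarrow> - X x \<in> W"
    "local_lipschitz (UNIV :: real set) (W \<inter> S) (\<lambda>_ x. - X x)"
    using X(1) W X(2) by (auto simp: subspace_neg local_lipschitz_minus)

  \<comment> \<open>The integrand as a continuous function\<close>
  obtain P :: "real^'n^'n" where P: "invertible P" "\<And>v w. ip v w = (P *v v) \<bullet> (P *v w)"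
    using inner_product_eq_inner[OF inner] by metis
  \<comment> \<open>\<open>P ** h t\<close> is an isometry from the moving inner product to the
    standard one, so on the interval of existence this is |q(\<gamma>(t))|_t, in a form whose
    continuity can be read off.\<close>
  define \<phi> where "\<phi> t = norm (tact var (P ** h t) (X (\<gamma> t)))" for t
  have inv: "invertible (h t)" and h: "(h has_vector_derivative - (h t ** Q t)) (at t)" if "t \<in> ?I" for t
    using gauge(2)[OF that] by auto
  have vel: "Q t \<in> transported_complement var (\<gamma> 0) \<qq> (\<gamma> t)" "X (\<gamma> t) = inf_act var (Q t) (\<gamma> t)"
    if "t \<in> ?I" for t
    using velocity[OF that] by (simp_all add: X_def)
  have \<phi>: "tensor_norm var (\<lambda>v w. ip (h t *v v) (h t *v w)) (X (\<gamma> t)) = \<phi> t" if "t \<in> ?I" for t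
    unfolding \<phi>_def using P inv[OF that]
    by (intro tensor_norm_eq_norm_tact) (simp_all add: invertible_mult matrix_vector_mul_assoc)
  have \<phi>_cont: "continuous_on ?I \<phi>"
    unfolding continuous_on_def
  proof
    fix t assume t: "t \<in> ?I"
    have h_lim: "(h \<longlongrightarrow> h t) (at t within ?I)"
      using has_vector_derivative_continuous[OF h[OF t]] continuous_at_imp_continuous_at_within
      by (auto simp: continuous_within)
    have "continuous_on ?I \<gamma>"
      using sol has_vector_derivative_continuous unfolding ode_solution_def
      by (intro continuous_at_imp_continuous_on) blast
    with local_lipschitz_continuous_on[OF X(2) UNIV_I] have "continuous_on ?I (\<lambda>t. X (\<gamma> t))"
      by (rule continuous_on_compose2) (use sol in \<open>auto simp: ode_solution_def\<close>)
    then have "((\<lambda>t. X (\<gamma> t)) \<longlongrightarrow> X (\<gamma> t)) (at t within ?I)"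
      using t by (simp add: continuous_on_def)
    then show "(\<phi> \<longlongrightarrow> \<phi> t) (at t within ?I)"
      unfolding \<phi>_def using P(1) inv[OF t]
      by (intro tendsto_norm tendsto_tact tendsto_matrix_mult h_lim) (auto intro: invertible_mult)
  qed
  \<comment> \<open>Covers both half-intervals; in each use 0 is an end of \<open>{c..d}\<close>
    that lies outside \<open>A\<close>.\<close>
  have bound: "integral {c..d} \<phi> \<le> enn2real (\<integral>\<^sup>+ t\<in>A.
      ennreal (tensor_norm var (\<lambda>v w. ip (h t *v v) (h t *v w)) (X (\<gamma> t))) \<partial>lborel)"
    if A: "A \<subseteq> ?I" "{c<..<d} \<subseteq> A" "{c..d} \<subseteq> ?I" and fin: "(\<integral>\<^sup>+ t\<in>A.
      ennreal (tensor_norm var (\<lambda>v w. ip (h t *v v) (h t *v w)) (X (\<gamma> t))) \<partial>lborel) \<noteq> \<infinity>" for A c d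
  proof -
    have eq: "(\<integral>\<^sup>+ t\<in>A. ennreal (tensor_norm var (\<lambda>v w. ip (h t *v v) (h t *v w)) (X (\<gamma> t))) \<partial>lborel)
        = (\<integral>\<^sup>+ t\<in>A. ennreal (\<phi> t) \<partial>lborel)"
      using A(1) \<phi> by (intro nn_integral_cong) (auto simp: indicator_def)
    show ?thesis
      using fin A unfolding eq
      by (intro integral_le_set_nn_integral continuous_on_subset[OF \<phi>_cont]) (auto simp: \<phi>_def)
  qed
  have sub: "ereal_interval 0 Tp \<subseteq> ?I" "ereal_interval Tm 0 \<subseteq> ?I"
    using less_trans[OF interval(1)] less_trans[OF _ interval(2)] by (auto simp: ereal_interval_def)
  show ?thesis
    unfolding X_def [symmetric]
  proof (intro conjI impI; rule ccontr)

    \<comment> \<open>Blow-up of the integral at a finite future end\<close>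
    let ?N = "\<integral>\<^sup>+ t\<in>ereal_interval 0 Tp.
      ennreal (tensor_norm var (\<lambda>v w. ip (h t *v v) (h t *v w)) (X (\<gamma> t))) \<partial>lborel"
    assume "Tp < \<infinity>" and fin: "?N \<noteq> \<infinity>"
    then obtain b where b: "Tp = ereal b" "0 < b"
      using interval(2) by (cases Tp) auto
    have "\<exists>b'>b. \<exists>\<delta>. ode_solution (W \<inter> S) X Tm (ereal b') \<delta> \<and> (\<forall>t\<in>ereal_interval Tm b. \<delta> t = \<gamma> t)"
    proof (rule solution_extends_forward[where \<gamma> = \<gamma> and h = h and Q = Q and \<qq> = \<qq>
          and var = var and P = P and M = "enn2real ?N"])
      show "integral {0..t} (\<lambda>t. norm (tact var (P ** h t) (X (\<gamma> t)))) \<le> enn2real ?N"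
        if "t \<in> {0..<b}" for t
        unfolding \<phi>_def [symmetric]
      proof (rule bound[OF sub(1) _ _ fin])
        show "{0<..<t} \<subseteq> ereal_interval 0 Tp" "{0..t} \<subseteq> ?I"
          using that b interval(1) by (auto simp: ereal_interval_def intro: less_le_trans)
      qed
    qed (use W U orbit X interval(1) b(2) sol complement vel gauge(1) inv h P(1) \<phi>_cont in
        \<open>auto simp: b(1) \<phi>_def[abs_def]\<close>)
    then obtain b' \<delta> where "b < b'" "ode_solution (W \<inter> S) X Tm (ereal b') \<delta>"
      "\<forall>t\<in>ereal_interval Tm b. \<delta> t = \<gamma> t"
      by blast
    then show False
      using maximal_ode_solution_no_extension(1)[OF max, of "ereal b'" \<delta>] by (simp add: b)
  next

    \<comment> \<open>Blow-up of the integral at a finite past end, by time reversal\<close>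
    let ?N = "\<integral>\<^sup>+ t\<in>ereal_interval Tm 0.
      ennreal (tensor_norm var (\<lambda>v w. ip (h t *v v) (h t *v w)) (X (\<gamma> t))) \<partial>lborel"
    assume "Tm > - \<infinity>" and fin: "?N \<noteq> \<infinity>"
    then obtain b where b: "Tm = ereal (- b)" "0 < b"
      using interval(1) by (cases Tm) (auto intro: that[of "- _"])
    have refl_I: "- t \<in> ?I" if "t \<in> ereal_interval (- Tp) b" for t
      using that by (simp add: uminus_mem_ereal_interval b)
    \<comment> \<open>Reversal negates the field and \<open>Q\<close>; the norm, and with it the
      integral bound, is blind to the sign.\<close>
    have \<phi>_refl: "norm (tact var (P ** h (- t)) (- X (\<gamma> (- t)))) = \<phi> (- t)" for t
      by (simp add: \<phi>_def linear_neg[OF linear_tact])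
    have "\<exists>b'>b. \<exists>\<delta>. ode_solution (W \<inter> S) (\<lambda>x. - X x) (- Tp) (ereal b') \<delta> \<and>
        (\<forall>t\<in>ereal_interval (- Tp) b. \<delta> t = \<gamma> (- t))"
    proof (rule solution_extends_forward[where \<gamma> = "\<lambda>t. \<gamma> (- t)" and h = "\<lambda>t. h (- t)"
          and Q = "\<lambda>t. - Q (- t)" and \<qq> = \<qq> and var = var and P = P and M = "enn2real ?N"])
      show "ode_solution (W \<inter> S) (\<lambda>x. - X x) (- Tp) (ereal b) (\<lambda>t. \<gamma> (- t))"
        using ode_solution_reflect[OF sol] by (simp add: b)
      show "- Tp < 0"
        using interval(2) by (simp add: ereal_uminus_less_reorder)
      show "invariant_complement var (\<gamma> (- 0)) \<qq>"
        using complement by simp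
      then have "subspace \<qq>"
        by (simp add: invariant_complement_def)
      fix t assume "t \<in> ereal_interval (- Tp) (ereal b)"
      then have t: "- t \<in> ?I"
        by (rule refl_I)
      show "- Q (- t) \<in> transported_complement var (\<gamma> (- 0)) \<qq> (\<gamma> (- t)) \<and>
          - X (\<gamma> (- t)) = inf_act var (- Q (- t)) (\<gamma> (- t))"
        using vel[OF t] transported_complement_uminus[OF \<open>subspace \<qq>\<close>]
        by (simp add: inf_act_eq_lin_act linear_neg[OF linear_lin_act])
      show "invertible (h (- t)) \<and> ((\<lambda>t. h (- t)) has_vector_derivative - (h (- t) ** - Q (- t))) (at t)"
        using inv[OF t] has_vector_derivative_reflect[OF h[OF t]] by (simp add: matrix_mult_minus_right)
    next
      show "continuous_on (ereal_interval (- Tp) (ereal b))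
          (\<lambda>t. norm (tact var (P ** h (- t)) (- X (\<gamma> (- t)))))"
        unfolding \<phi>_refl
        by (rule continuous_on_compose2[OF \<phi>_cont]) (auto intro!: continuous_intros refl_I)
      fix t assume t: "t \<in> {0..<b}"
      have "integral {0..t} (\<lambda>t. \<phi> (- t)) = integral {- t..0} \<phi>"
        using Henstock_Kurzweil_Integration.integral_reflect_real[of 0 "- t" \<phi>] by simp
      also have "\<dots> \<le> enn2real ?N"
      proof (rule bound[OF sub(2) _ _ fin])
        show "{- t<..<0} \<subseteq> ereal_interval Tm 0"
          using t b by (auto simp: ereal_interval_def)
        show "{- t..0} \<subseteq> ?I"
          using t b interval(2) by (cases Tp) (auto simp: ereal_interval_def)
      qed
      finally show "integral {0..t} (\<lambda>t. norm (tact var (P ** h (- t)) (- X (\<gamma> (- t))))) \<le> enn2real ?N"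
        unfolding \<phi>_refl .
    qed (use W U orbit neg_X b P(1) gauge(1) in auto)
    then obtain b' \<delta> where b': "b < b'" and \<delta>: "ode_solution (W \<inter> S) (\<lambda>x. - X x) (- Tp) (ereal b') \<delta>"
      "\<forall>t\<in>ereal_interval (- Tp) b. \<delta> t = \<gamma> (- t)"
      by blast
    \<comment> \<open>Reflecting once more gives an extension of the original solution into the
      past.\<close>
    have "ode_solution (W \<inter> S) X (ereal (- b')) Tp (\<lambda>t. \<delta> (- t))"
      using ode_solution_reflect[OF \<delta>(1)] by simp
    moreover have "\<forall>t\<in>?I. \<delta> (- t) = \<gamma> t"
    proof
      fix t assume "t \<in> ?I"
      then have "- t \<in> ereal_interval (- Tp) b"
        by (simp add: uminus_mem_ereal_interval b)
      then show "\<delta> (- t) = \<gamma> t"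
        using \<delta>(2) by fastforce
    qed
    ultimately show False
      using maximal_ode_solution_no_extension(2)[OF max, of "ereal (- b')" "\<lambda>t. \<delta> (- t)"] b'
      by (simp add: b)
  qed
qed

end
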